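(* Let $\Gamma$ be any countably infinite group and let $\{\Delta_n : n\in\mathbb{N}\}$ be any collection of infinite normal subgroups of $\Gamma$. Then there is a free $\Gamma$-flow which is minimal as a $\Delta_n$-flow for every $n\in\mathbb{N}$.
   Context: A $\Gamma$-flow is a non-empty compact Hausdorff space $X$ with a continuous action of $\Gamma$ (as a discrete group). For a subgroup $\Delta\subseteq\Gamma$, a $\Gamma$-flow is regarded as a $\Delta$-flow by restricting the action, and it is minimal as a $\Delta$-flow if every $\Delta$-orbit is dense. A $\Gamma$-flow $X$ is free if $gx\neq x$ for every $g\in\Gamma\setminus\{1_\Gamma\}$ and every $x\in X$. *)

theory Defs
  imports "HOL-Analysis.Analysis" "HOL-Algebra.Group_Action"
begin

no_notation eq_closure_of (\<open>closure'_of\<index>\<close>)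

definition flow :: "('g, 'm) monoid_scheme \<Rightarrow> 'x topology \<Rightarrow> ('g \<Rightarrow> 'x \<Rightarrow> 'x) \<Rightarrow> bool" where
  "flow G X \<phi> \<longleftrightarrow>
     topspace X \<noteq> {} \<and> compact_space X \<and> Hausdorff_space X \<and>
     group_action G (topspace X) \<phi> \<and>
     continuous_map (prod_topology (discrete_topology (carrier G)) X) X (\<lambda>(g, x). \<phi> g x)"

definition free_flow :: "('g, 'm) monoid_scheme \<Rightarrow> 'x topology \<Rightarrow> ('g \<Rightarrow> 'x \<Rightarrow> 'x) \<Rightarrow> bool" where
  "free_flow G X \<phi> \<longleftrightarrow>
     flow G X \<phi> \<and> (\<forall>g\<in>carrier G - {\<one>\<^bsub>G\<^esub>}. \<forall>x\<in>topspace X. \<phi> g x \<noteq> x)"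

definition minimal_flow :: "('g, 'm) monoid_scheme \<Rightarrow> 'x topology \<Rightarrow> ('g \<Rightarrow> 'x \<Rightarrow> 'x) \<Rightarrow> bool" where
  "minimal_flow G X \<phi> \<longleftrightarrow>
     flow G X \<phi> \<and> (\<forall>x\<in>topspace X. X closure_of (orbit G \<phi> x) = topspace X)"

(* A flow of G is regarded as a flow of a subgroup H by passing to G\<lparr>carrier := H\<rparr>,
   with the same \<phi>. *)
lemma flow_restrict:
  assumes "flow G X \<phi>" "subgroup H G"
  shows "flow (G\<lparr>carrier := H\<rparr>) X \<phi>"
proof -
  interpret group_action G "topspace X" \<phi>
    using assms(1) by (simp add: flow_def)
  have H: "H \<subseteq> carrier G" using assms(2) by (rule subgroup.subset)
  have ga: "group_action (G\<lparr>carrier := H\<rparr>) (topspace X) \<phi>"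
    using assms(2) group_hom group_hom.axioms(1)
    by (auto intro: induced_action)
  have "continuous_map (discrete_topology H) (discrete_topology (carrier G)) id"
    using H by auto
  then have "continuous_map (prod_topology (discrete_topology H) X)
               (discrete_topology (carrier G)) (id \<circ> fst)"
    by (rule continuous_map_compose[OF continuous_map_fst])
  then have "continuous_map (prod_topology (discrete_topology H) X)
          (prod_topology (discrete_topology (carrier G)) X) (\<lambda>p. (fst p, snd p))"
    by (intro continuous_map_pairedI continuous_map_snd) (simp add: o_def)
  then have "continuous_map (prod_topology (discrete_topology H) X) X
          ((\<lambda>(g, x). \<phi> g x) \<circ> (\<lambda>p. (fst p, snd p)))"
    using assms(1) unfolding flow_def by (blast intro: continuous_map_compose)
  then have "continuous_map (prod_topology (discrete_topology H) X) X (\<lambda>(g, x). \<phi> g x)"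
    by (simp add: o_def case_prod_unfold)
  with assms(1) ga show ?thesis by (simp add: flow_def)
qed

(* The existence of a minimal flow of G, on a space of any type, can be stated with spaces
   over the single type 'g set set: a minimal flow has a dense orbit indexed by G, so its
   underlying set injects into that type and the flow can be transported there. *)
lemma minimal_flow_inj_set_set:
  fixes G :: "('g, 'm) monoid_scheme" and X :: "'x topology"
  assumes "minimal_flow G X \<phi>"
  shows "\<exists>f :: 'x \<Rightarrow> 'g set set. inj_on f (topspace X)"
proof -
  obtain z where z: "z \<in> topspace X"
    using assms unfolding minimal_flow_def flow_def by blast
  have dense: "X closure_of (orbit G \<phi> z) = topspace X"
    using assms z unfolding minimal_flow_def by blast
  have haus: "Hausdorff_space X"
    using assms unfolding minimal_flow_def flow_def by blast
  define f where "f x = {S. x \<in> X closure_of ((\<lambda>g. \<phi> g z) ` S)}" for x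
  have "inj_on f (topspace X)"
  proof (rule inj_onI, rule ccontr)
    fix x y assume x: "x \<in> topspace X" and y: "y \<in> topspace X"
      and eq: "f x = f y" and ne: "x \<noteq> y"
    obtain U V where UV: "openin X U" "openin X V" "x \<in> U" "y \<in> V" "disjnt U V"
      using haus x y ne unfolding Hausdorff_space_def by blast
    define S where "S = {g \<in> carrier G. \<phi> g z \<in> U}"
    have "x \<in> X closure_of ((\<lambda>g. \<phi> g z) ` S)"
      unfolding in_closure_of
    proof (intro conjI allI impI)
      fix T assume T: "x \<in> T \<and> openin X T"
      then have "openin X (T \<inter> U)" "x \<in> T \<inter> U" using UV by auto
      moreover have "x \<in> X closure_of (orbit G \<phi> z)" using dense x by simp
      ultimately obtain w where "w \<in> orbit G \<phi> z" "w \<in> T \<inter> U"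
        unfolding in_closure_of by blast
      then show "\<exists>w. w \<in> (\<lambda>g. \<phi> g z) ` S \<and> w \<in> T"
        unfolding orbit_def S_def by blast
    qed (rule x)
    then have "y \<in> X closure_of ((\<lambda>g. \<phi> g z) ` S)"
      using eq unfolding f_def by blast
    then obtain w where "w \<in> (\<lambda>g. \<phi> g z) ` S" "w \<in> V"
      using UV unfolding in_closure_of by blast
    then show False using UV unfolding S_def disjnt_def by blast
  qed
  then show ?thesis by blast
qed

end

(* Work with the shift on three-colourings of infinitely many layers of the group. A proper
   colouring of layer n for right translation by the n-th group element makes that element act
   freely. Starting from the full shift, build a decreasing sequence of invariant sets, each strongly
   irreducible: any configurations prescribed far enough apart can be glued. At each step colour one
   more layer, and then keep only those configurations that carry a copy of one fixed pattern q at all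
   points of some maximal V-separated set, where q contains every pattern of a given finite window
   at translates by elements of N = \<Delta> k. If V contains suitable conjugates of
   elements of N, then every maximal V-separated set meets every coset of N within a fixed finite
   set, so all patterns recur along N. Maximal separated sets can be prescribed freely on distant
   regions and extended by Zorn's lemma, so strong irreducibility persists. The intersection of the
   closures is nonempty by compactness; it is free, and minimal for every \<Delta> k. *)
theory Submission
  imports Defs
begin

subsection \<open>Separated sets and colourings\<close>

text \<open>Zorn's lemma for independent sets between \<open>A\<close> and \<open>U\<close>: any two
  points of the union of a chain lie in a common member. It yields both proper colourings and
  maximal separated sets.\<close>

lemma maximal_independent_extension:
  assumes sym: "\<And>a b. R a b \<Longrightarrow> R b a"
    and "A \<subseteq> U" and "\<And>a b. a \<in> A \<Longrightarrow> b \<in> A \<Longrightarrow> a \<noteq> b \<Longrightarrow> \<not> R a b"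
  obtains M where "A \<subseteq> M" "M \<subseteq> U" "\<And>a b. a \<in> M \<Longrightarrow> b \<in> M \<Longrightarrow> a \<noteq> b \<Longrightarrow> \<not> R a b"
    "\<And>u. u \<in> U - M \<Longrightarrow> \<exists>m\<in>M. R u m"
proof -
  define F where "F = {M. A \<subseteq> M \<and> M \<subseteq> U \<and> (\<forall>a\<in>M. \<forall>b\<in>M. a \<noteq> b \<longrightarrow> \<not> R a b)}"
  have "A \<in> F" using assms by (auto simp: F_def)
  moreover have "\<Union>C \<in> F" if "C \<noteq> {}" and C: "subset.chain F C" for C
  proof -
    have CF: "C \<subseteq> F" and lin: "\<And>X Y. X \<in> C \<Longrightarrow> Y \<in> C \<Longrightarrow> X \<subseteq> Y \<or> Y \<subseteq> X"
      using C by (auto simp: subset_chain_def)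
    have "\<not> R a b" if "a \<in> X" "X \<in> C" "b \<in> Y" "Y \<in> C" "a \<noteq> b" for a b X Y
      using lin[of X Y] that CF unfolding F_def by blast
    then show ?thesis
      using CF \<open>C \<noteq> {}\<close> unfolding F_def by (auto simp: subset_iff; blast)
  qed
  ultimately obtain M where M: "M \<in> F" "\<And>X. X \<in> F \<Longrightarrow> M \<subseteq> X \<Longrightarrow> X = M"
    using subset_Zorn_nonempty[of F] by blast
  have "\<exists>m\<in>M. R u m" if u: "u \<in> U - M" for u
  proof (rule ccontr)
    assume "\<not> ?thesis"
    then have "insert u M \<in> F"
      using M(1) u sym unfolding F_def by blast
    then show False using M(2) u by blast
  qed
  with M(1) show thesis by (intro that[of M]) (auto simp: F_def)
qed

section \<open>Left-invariant nearness in a group\<close>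

context group
begin

text \<open>Inside the group this says that \<open>t\<close> lies in the left translate of
  \<open>A\<close> by \<open>s\<close>. The relation is invariant under left multiplication, the
  side on which \<open>shift\<close> acts.\<close>

definition near :: "'a set \<Rightarrow> 'a \<Rightarrow> 'a \<Rightarrow> bool" where
  "near A s t \<longleftrightarrow> inv s \<otimes> t \<in> A"

lemma near_trans:
  assumes "near A s t" "near B t u" "s \<in> carrier G" "t \<in> carrier G" "u \<in> carrier G"
  shows "near (A <#> B) s u"
proof -
  have "inv s \<otimes> u = (inv s \<otimes> t) \<otimes> (inv t \<otimes> u)"
    using assms(3-) by (simp add: m_assoc inv_solve_left flip: m_assoc[of t "inv t" u])
  then show ?thesis
    using assms(1,2) unfolding near_def set_mult_def by auto
qed

lemma near_sym:
  assumes "near A s t" "s \<in> carrier G" "t \<in> carrier G"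
  shows "near (set_inv A) t s"
proof -
  have "inv t \<otimes> s = inv (inv s \<otimes> t)"
    using assms(2-) by (simp add: inv_mult_group)
  then show ?thesis
    using assms(1) unfolding near_def SET_INV_def by auto
qed

lemma near_refl: "\<one> \<in> A \<Longrightarrow> s \<in> carrier G \<Longrightarrow> near A s s"
  by (simp add: near_def)

lemma near_mono: "near A s t \<Longrightarrow> A \<subseteq> B \<Longrightarrow> near B s t"
  by (auto simp: near_def)

lemma near_shift:
  "g \<in> carrier G \<Longrightarrow> s \<in> carrier G \<Longrightarrow> t \<in> carrier G \<Longrightarrow> near A (g \<otimes> s) t \<longleftrightarrow> near A s (inv g \<otimes> t)"
  by (simp add: near_def inv_mult_group m_assoc)

lemma finite_set_mult: "finite A \<Longrightarrow> finite B \<Longrightarrow> finite (A <#> B)"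
  by (simp add: set_mult_def)

lemma finite_set_inv: "finite A \<Longrightarrow> finite (set_inv A)"
  by (simp add: SET_INV_def)

lemma set_inv_closed: "A \<subseteq> carrier G \<Longrightarrow> set_inv A \<subseteq> carrier G"
  by (auto simp: SET_INV_def)

text \<open>Joining every \<open>h\<close> to \<open>h \<otimes> g\<close> gives a graph of degree
  at most two, so three colours leave one free at any uncoloured vertex. Sets of pairs (vertex,
  colour) encode partial colourings, and a maximal independent set of pairs is a total one.\<close>

lemma proper_colouring_extension:
  fixes w :: "'a \<Rightarrow> nat"
  assumes g: "g \<in> carrier G" "g \<noteq> \<one>" and P: "P \<subseteq> carrier G" "w \<in> P \<rightarrow> {..<3}"
    and w: "\<And>h. h \<in> P \<Longrightarrow> h \<otimes> g \<in> P \<Longrightarrow> w h \<noteq> w (h \<otimes> g)"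
  shows "\<exists>c. c \<in> carrier G \<rightarrow> {..<3} \<and> (\<forall>h\<in>P. c h = w h) \<and> (\<forall>h\<in>carrier G. c h \<noteq> c (h \<otimes> g))"
proof -
  \<comment> \<open>Pairs conflict if they sit at the same vertex or give neighbours the same
    colour, so independent sets are the graphs of proper partial colourings.\<close>
  define R where "R = (\<lambda>(h, c::nat) (h', c'). h = h' \<or> c = c' \<and> (h' = h \<otimes> g \<or> h = h' \<otimes> g))"
  have Rsym: "R a b \<Longrightarrow> R b a" for a b by (auto simp: R_def)
  obtain M where M: "(\<lambda>h. (h, w h)) ` P \<subseteq> M" "M \<subseteq> carrier G \<times> {..<3}"
    and indep: "\<And>a b. a \<in> M \<Longrightarrow> b \<in> M \<Longrightarrow> a \<noteq> b \<Longrightarrow> \<not> R a b"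
    and maxi: "\<And>u. u \<in> carrier G \<times> {..<3} - M \<Longrightarrow> \<exists>m\<in>M. R u m"
  proof (rule maximal_independent_extension[of R "(\<lambda>h. (h, w h)) ` P" "carrier G \<times> {..<3}"])
    show "(\<lambda>h. (h, w h)) ` P \<subseteq> carrier G \<times> {..<3}" using P by auto
    show "\<not> R a b" if "a \<in> (\<lambda>h. (h, w h)) ` P" "b \<in> (\<lambda>h. (h, w h)) ` P" "a \<noteq> b" for a b
      using that w[of "fst a"] w[of "fst b"] by (auto simp: R_def)
  qed (use Rsym in blast)+
  have uniq: "c = c'" if "(h, c) \<in> M" "(h, c') \<in> M" for h c c'
    using indep[OF that] by (auto simp: R_def)
  have ex: "\<exists>c. (h, c) \<in> M" if h: "h \<in> carrier G" for h
  proof (rule ccontr)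
    assume no: "\<nexists>c. (h, c) \<in> M"
    have blocked: "(h \<otimes> g, c) \<in> M \<or> (h \<otimes> inv g, c) \<in> M" if c: "c < 3" for c
    proof -
      obtain h' c' where m: "(h', c') \<in> M" "R (h, c) (h', c')"
        using maxi[of "(h, c)"] h c no by auto
      then have "c = c'" "h' = h \<otimes> g \<or> h = h' \<otimes> g" using no by (auto simp: R_def)
      moreover have "h' \<in> carrier G" using m M by auto
      ultimately show ?thesis using m g h by (auto simp: m_assoc)
    qed
    \<comment> \<open>Three blocked colours would have to be shared by two neighbours, each of which
      carries at most one.\<close>
    have "\<not> ((x, i) \<in> M \<and> (x, j) \<in> M)" if "i \<noteq> j" for x i j using uniq that by blast
    from this[of 0 1] this[of 0 2] this[of 1 2] blocked[of 0] blocked[of 1] blocked[of 2]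
    show False by simp blast
  qed
  define c where "c h = (THE k. (h, k) \<in> M)" for h
  have c: "(h, c h) \<in> M" if "h \<in> carrier G" for h
    unfolding c_def using ex[OF that] uniq by (metis theI')
  show ?thesis
  proof (intro exI[of _ c] conjI ballI)
    show "c \<in> carrier G \<rightarrow> {..<3}" using c M by auto
    show "c h = w h" if "h \<in> P" for h
      using uniq[OF c[of h], of "w h"] that M(1) P(1) by blast
    show "c h \<noteq> c (h \<otimes> g)" if h: "h \<in> carrier G" for h
    proof
      assume eq: "c h = c (h \<otimes> g)"
      have "h \<noteq> h \<otimes> g" using h g by simp
      then show False
        using indep[OF c[of h] c[of "h \<otimes> g"]] h g eq by (auto simp: R_def)
    qed
  qed
qed

section \<open>Maximal separated sets\<close>

definition maxsep :: "'a set \<Rightarrow> 'a set \<Rightarrow> bool" where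
  "maxsep V S \<longleftrightarrow> S \<subseteq> carrier G \<and> (\<forall>s\<in>S. \<forall>t\<in>S. near V s t \<longrightarrow> s = t) \<and>
     (\<forall>t\<in>carrier G. \<exists>s\<in>S. near V t s)"

text \<open>For symmetric \<open>V\<close> containing the identity, the last clause of
  \<open>maxsep\<close> expresses maximality: a point outside \<open>S\<close> is excluded by a
  nearby point of \<open>S\<close>, and a point of \<open>S\<close> is near itself.\<close>

lemma maxsep_extension:
  assumes V: "\<one> \<in> V" "set_inv V = V"
    and A: "A \<subseteq> carrier G" "\<And>s t. s \<in> A \<Longrightarrow> t \<in> A \<Longrightarrow> near V s t \<Longrightarrow> s = t"
  obtains S where "maxsep V S" "A \<subseteq> S"
proof -
  define R where "R a b \<longleftrightarrow> a \<in> carrier G \<and> b \<in> carrier G \<and> near V a b" for a b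
  obtain S where S: "A \<subseteq> S" "S \<subseteq> carrier G" "\<And>a b. a \<in> S \<Longrightarrow> b \<in> S \<Longrightarrow> a \<noteq> b \<Longrightarrow> \<not> R a b"
    "\<And>u. u \<in> carrier G - S \<Longrightarrow> \<exists>m\<in>S. R u m"
  proof (rule maximal_independent_extension[of R A "carrier G"])
    show "R b a" if "R a b" for a b
      using that near_sym[of V a b] V by (auto simp: R_def)
    show "\<not> R a b" if "a \<in> A" "b \<in> A" "a \<noteq> b" for a b
      using that A(2) by (auto simp: R_def)
  qed (use A(1) in blast)+
  have "\<exists>s\<in>S. near V t s" if "t \<in> carrier G" for t
    using near_refl[OF V(1) that] S(4)[of t] that unfolding R_def by (cases "t \<in> S") auto
  moreover have "s = t" if "s \<in> S" "t \<in> S" "near V s t" for s t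
    using S(3)[of s t] S(2) that by (auto simp: R_def)
  ultimately have "maxsep V S"
    using S(2) unfolding maxsep_def by blast
  then show thesis using S(1) that by blast
qed

lemma maxsep_shift:
  assumes "maxsep V S" "g \<in> carrier G"
  shows "maxsep V ((\<otimes>) g ` S)"
proof -
  have S: "S \<subseteq> carrier G" "\<And>s t. s \<in> S \<Longrightarrow> t \<in> S \<Longrightarrow> near V s t \<Longrightarrow> s = t"
    "\<And>t. t \<in> carrier G \<Longrightarrow> \<exists>s\<in>S. near V t s"
    using assms(1) by (auto simp: maxsep_def)
  have cancel: "near V (g \<otimes> s) (g \<otimes> t) \<longleftrightarrow> near V s t" if "s \<in> carrier G" "t \<in> carrier G" for s t
    using that assms(2) near_shift[of g s "g \<otimes> t" V] by (simp flip: m_assoc)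
  have "\<exists>s\<in>S. near V t (g \<otimes> s)" if t: "t \<in> carrier G" for t
  proof -
    obtain s where s: "s \<in> S" "near V (inv g \<otimes> t) s" using S(3)[of "inv g \<otimes> t"] t assms(2) by auto
    then have "near V (g \<otimes> (inv g \<otimes> t)) (g \<otimes> s)"
      using cancel[of "inv g \<otimes> t" s] S(1) t assms(2) by auto
    moreover have "g \<otimes> (inv g \<otimes> t) = t" using t assms(2) by (simp flip: m_assoc)
    ultimately show ?thesis using s by auto
  qed
  moreover have "s = t" if "s \<in> (\<otimes>) g ` S" "t \<in> (\<otimes>) g ` S" "near V s t" for s t
    using that S(1,2) cancel by blast
  moreover have "(\<otimes>) g ` S \<subseteq> carrier G" using S(1) assms(2) by blast
  ultimately show ?thesis unfolding maxsep_def by blast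
qed

(* V is the union of U and a finite W \<subseteq> N. If no point k w of S with k \<in> K, w \<in> W exists, maximality
   gives a point k u of S with u \<in> U for every k \<in> K. By pigeonhole two k, l \<in> K share the same u; the
   quotient inv u (inv k l) u of their points lies in W by choice of W (in N by normality),
   contradicting separation. *)
lemma maxsep_meets_normal:
  assumes N: "N \<lhd> G" "infinite N" and U: "finite U" "U \<subseteq> carrier G" "set_inv U = U"
  obtains V where "finite V" "V \<subseteq> carrier G" "\<one> \<in> V" "set_inv V = V" "U \<subseteq> V"
    "\<exists>L. finite L \<and> L \<subseteq> N \<and> (\<forall>S. maxsep V S \<longrightarrow> S \<inter> L \<noteq> {})"
proof -
  interpret N: normal N G by (rule N(1))
  obtain K where K: "K \<subseteq> N" "finite K" "card K = Suc (card U)"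
    using infinite_arbitrarily_large[OF N(2)] by metis
  have KG: "k \<in> carrier G" if "k \<in> K" for k using K(1) N.subset that by blast
  define W where "W = insert \<one> ((\<lambda>(u, k, l). inv u \<otimes> (inv k \<otimes> l) \<otimes> u) ` (U \<times> K \<times> K))"
  have WN: "W \<subseteq> N"
    using K(1) U(2) N.inv_op_closed1 unfolding W_def by (force simp: subset_iff)
  have Winv: "inv w \<in> W" if w: "w \<in> W" for w
  proof -
    consider "w = \<one>" | u k l where "u \<in> U" "k \<in> K" "l \<in> K" "w = inv u \<otimes> (inv k \<otimes> l) \<otimes> u"
      using w by (auto simp: W_def)
    then show ?thesis
    proof cases
      case 2
      then have "inv w = inv u \<otimes> (inv l \<otimes> k) \<otimes> u"
        using KG U(2) by (simp add: subset_iff inv_mult_group m_assoc)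
      then show ?thesis using 2 by (force simp: W_def)
    qed (simp add: W_def)
  qed
  define V where "V = U \<union> W"
  define L where "L = K <#> W"
  have L: "finite L" "L \<subseteq> N"
  proof -
    show "finite L" using K(2) U(1) by (simp add: L_def W_def finite_set_mult)
    show "L \<subseteq> N" using K(1) WN by (auto simp: L_def set_mult_def)
  qed
  have Vinv: "set_inv V = V"
  proof -
    have "inv v \<in> V" if "v \<in> V" for v
      using that Winv U(3) by (auto simp: V_def SET_INV_def)
    moreover have "inv (inv v) = v" if "v \<in> V" for v
      using that U WN N.subset by (auto simp: V_def)
    ultimately show ?thesis unfolding SET_INV_def by (auto simp: image_iff) metis
  qed
  show thesis
  proof (rule that[of V])
    show "finite V" using U K by (simp add: V_def W_def)
    show "V \<subseteq> carrier G" using U WN N.subset by (auto simp: V_def)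
    show "\<one> \<in> V" by (simp add: V_def W_def)
    have "S \<inter> L \<noteq> {}" if S: "maxsep V S" for S
    proof
      assume empty: "S \<inter> L = {}"
      have "\<exists>u\<in>U. k \<otimes> u \<in> S" if k: "k \<in> K" for k
      proof -
        obtain s where s: "s \<in> S" "inv k \<otimes> s \<in> V" "s \<in> carrier G"
          using S KG[OF k] unfolding maxsep_def near_def by blast
        have sk: "k \<otimes> (inv k \<otimes> s) = s" using s KG[OF k] by (simp flip: m_assoc)
        then have "inv k \<otimes> s \<notin> W" using empty s(1) k unfolding L_def set_mult_def by fastforce
        then show ?thesis using s sk by (intro bexI[of _ "inv k \<otimes> s"]) (auto simp: V_def)
      qed
      then obtain f where f: "\<And>k. k \<in> K \<Longrightarrow> f k \<in> U \<and> k \<otimes> f k \<in> S" by metis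
      then have "f ` K \<subseteq> U" by auto
      then have "\<not> inj_on f K"
        using K(3) U(1) card_inj_on_le[of f K U] by auto
      then obtain k l where kl: "k \<in> K" "l \<in> K" "k \<noteq> l" "f k = f l" by (auto simp: inj_on_def)
      have u: "f k \<in> U" "f k \<in> carrier G" using f[OF kl(1)] U by auto
      have "inv (k \<otimes> f k) \<otimes> (l \<otimes> f l) = inv (f k) \<otimes> (inv k \<otimes> l) \<otimes> f k"
        using u KG kl by (simp add: inv_mult_group m_assoc)
      also have "\<dots> \<in> W" using u kl by (force simp: W_def)
      finally have "k \<otimes> f k = l \<otimes> f l"
        using S f[OF kl(1)] f[OF kl(2)] unfolding maxsep_def near_def V_def by blast
      then show False using kl u KG by simp
    qed
    then show "\<exists>L. finite L \<and> L \<subseteq> N \<and> (\<forall>S. maxsep V S \<longrightarrow> S \<inter> L \<noteq> {})" using L by blast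
  qed (auto simp: V_def Vinv[unfolded V_def])
qed

text \<open>The values of \<open>\<delta>\<close> are chosen one at a time: the infinite
  \<open>N\<close> has a point outside the finite set of points near an earlier choice in either
  direction. They will keep copies of different patterns apart.\<close>

lemma spread_translates:
  assumes N: "subgroup N G" "infinite N" and "finite R" "finite W" "W \<subseteq> carrier G"
  obtains \<delta> where "\<delta> \<in> R \<rightarrow> N" "\<And>r r'. r \<in> R \<Longrightarrow> r' \<in> R \<Longrightarrow> near W (\<delta> r) (\<delta> r') \<Longrightarrow> r = r'"
proof -
  interpret N: subgroup N G by (rule N(1))
  from \<open>finite R\<close> have "\<exists>\<delta>. \<delta> \<in> R \<rightarrow> N \<and> (\<forall>r\<in>R. \<forall>r'\<in>R. near W (\<delta> r) (\<delta> r') \<longrightarrow> r = r')"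
  proof (induction R)
    case (insert a R)
    then obtain \<delta> where \<delta>: "\<delta> \<in> R \<rightarrow> N" "\<And>r r'. r \<in> R \<Longrightarrow> r' \<in> R \<Longrightarrow> near W (\<delta> r) (\<delta> r') \<Longrightarrow> r = r'"
      by auto
    have "finite ((\<delta> ` R) <#> (W \<union> set_inv W))"
      using insert assms(4) by (intro finite_set_mult) (auto simp: finite_set_inv)
    then obtain d where d: "d \<in> N" "d \<notin> (\<delta> ` R) <#> (W \<union> set_inv W)"
      using N(2) by (meson finite_subset subsetI)
    have *: "\<not> near (W \<union> set_inv W) (\<delta> r) d" if "r \<in> R" for r
    proof
      assume "near (W \<union> set_inv W) (\<delta> r) d"
      moreover have "d = \<delta> r \<otimes> (inv (\<delta> r) \<otimes> d)"
        using d(1) \<delta>(1) that N.subset by (auto simp flip: m_assoc simp: Pi_iff subset_iff)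
      ultimately show False using d(2) that unfolding near_def set_mult_def by blast
    qed
    have "\<not> near W (\<delta> r) d" "\<not> near W d (\<delta> r)" if "r \<in> R" for r
    proof -
      show "\<not> near W (\<delta> r) d" using *[OF that] near_mono by blast
      show "\<not> near W d (\<delta> r)"
        using *[OF that] near_mono near_sym[of W d "\<delta> r"] d(1) \<delta>(1) that N.subset by blast
    qed
    then show ?case
      using \<delta> d(1) insert(2) by (intro exI[of _ "\<delta>(a := d)"]) (auto simp: Pi_iff)
  qed auto
  then obtain \<delta> where "\<delta> \<in> R \<rightarrow> N" "\<forall>r\<in>R. \<forall>r'\<in>R. near W (\<delta> r) (\<delta> r') \<longrightarrow> r = r'"
    by (elim exE conjE)
  then show thesis by (intro that[of \<delta>]) simp_all
qed


subsection \<open>Strongly irreducible sets of configurations\<close>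

definition config :: "('a \<times> nat \<Rightarrow> nat) topology" where
  "config = product_topology (\<lambda>_. discrete_topology {..<3}) (carrier G \<times> UNIV)"

definition shift :: "'a \<Rightarrow> ('a \<times> nat \<Rightarrow> nat) \<Rightarrow> 'a \<times> nat \<Rightarrow> nat" where
  "shift g x = (\<lambda>(h, n)\<in>carrier G \<times> UNIV. x (inv g \<otimes> h, n))"

lemma topspace_config: "topspace config = (carrier G \<times> UNIV) \<rightarrow>\<^sub>E {..<3}"
  by (simp add: config_def topspace_product_topology)

lemma config_less: "x \<in> topspace config \<Longrightarrow> h \<in> carrier G \<Longrightarrow> x (h, n) < 3"
  by (auto simp: topspace_config PiE_iff)

lemma shift_apply: "h \<in> carrier G \<Longrightarrow> shift g x (h, n) = x (inv g \<otimes> h, n)"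
  by (simp add: shift_def)

lemma shift_closed: "g \<in> carrier G \<Longrightarrow> x \<in> topspace config \<Longrightarrow> shift g x \<in> topspace config"
  unfolding topspace_config shift_def by (auto simp: PiE_iff)

lemma config_eqI:
  assumes "x \<in> topspace config" "y \<in> topspace config"
    and "\<And>h n. h \<in> carrier G \<Longrightarrow> x (h, n) = y (h, n)"
  shows "x = y"
  using assms unfolding topspace_config by (intro PiE_ext[of x _ _ y]) auto

lemma shift_one: "x \<in> topspace config \<Longrightarrow> shift \<one> x = x"
  by (rule config_eqI) (auto simp: shift_closed shift_apply)

lemma shift_mult:
  assumes "g \<in> carrier G" "h \<in> carrier G" "x \<in> topspace config"
  shows "shift (g \<otimes> h) x = shift g (shift h x)"
  using assms by (intro config_eqI) (auto simp: shift_closed shift_apply inv_mult_group m_assoc)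

(* \<xi> t is the configuration to be imitated at the point t; taking \<xi> constant on regions that are
   D-apart from each other gives strong irreducibility for any number of regions at once. *)
definition glues :: "'a set \<Rightarrow> ('a \<times> nat \<Rightarrow> nat) set \<Rightarrow> bool" where
  "glues D X \<longleftrightarrow> (\<forall>P \<xi>. P \<subseteq> carrier G \<longrightarrow> \<xi> \<in> P \<rightarrow> X \<longrightarrow>
     (\<forall>s\<in>P. \<forall>t\<in>P. near D s t \<longrightarrow> \<xi> s = \<xi> t) \<longrightarrow> (\<exists>z\<in>X. \<forall>t\<in>P. \<forall>j. z (t, j) = \<xi> t (t, j)))"

lemma gluesD:
  assumes "glues D X" "P \<subseteq> carrier G" "\<And>t. t \<in> P \<Longrightarrow> \<xi> t \<in> X"
    and "\<And>s t. s \<in> P \<Longrightarrow> t \<in> P \<Longrightarrow> near D s t \<Longrightarrow> \<xi> s = \<xi> t"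
  shows "\<exists>z\<in>X. \<forall>t\<in>P. \<forall>j. z (t, j) = \<xi> t (t, j)"
  using assms(1)[unfolded glues_def, rule_format, of P \<xi>] assms(2-) by (simp add: Pi_iff)

lemma glues_mono:
  assumes "glues D X" "D \<subseteq> E"
  shows "glues E X"
  unfolding glues_def
proof (intro allI impI)
  fix P \<xi>
  assume P: "P \<subseteq> carrier G" "\<xi> \<in> P \<rightarrow> X" and eq: "\<forall>s\<in>P. \<forall>t\<in>P. near E s t \<longrightarrow> \<xi> s = \<xi> t"
  show "\<exists>z\<in>X. \<forall>t\<in>P. \<forall>j. z (t, j) = \<xi> t (t, j)"
  proof (rule gluesD[OF assms(1) P(1), of \<xi>])
    show "\<xi> t \<in> X" if "t \<in> P" for t using P(2) that by auto
    show "\<xi> s = \<xi> t" if "s \<in> P" "t \<in> P" "near D s t" for s t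
      using eq that(1,2) near_mono[OF that(3) assms(2)] by simp
  qed
qed

text \<open>Gluing over the empty region already produces a member.\<close>

lemma glues_nonempty:
  assumes "glues D X"
  shows "X \<noteq> {}"
proof -
  have "\<exists>z\<in>X. \<forall>t\<in>{}. \<forall>j. z (t, j) = undefined t (t, j)"
    by (rule gluesD[OF assms]) auto
  then show ?thesis by blast
qed

section \<open>The invariant of the construction\<close>

definition depends :: "nat \<Rightarrow> ('a \<times> nat \<Rightarrow> nat) set \<Rightarrow> bool" where
  "depends n X \<longleftrightarrow> (\<forall>x\<in>X. \<forall>y\<in>topspace config.
     (\<forall>h\<in>carrier G. \<forall>j<n. y (h, j) = x (h, j)) \<longrightarrow> y \<in> X)"

text \<open>What every stage of the construction must satisfy. \<open>depends n\<close> keeps the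
  layers from \<open>n\<close> on unconstrained, ready for later colourings. Closures are taken only
  once the whole sequence is built.\<close>

definition flexible :: "nat \<Rightarrow> ('a \<times> nat \<Rightarrow> nat) set \<Rightarrow> bool" where
  "flexible n X \<longleftrightarrow> X \<subseteq> topspace config \<and> (\<forall>g\<in>carrier G. \<forall>x\<in>X. shift g x \<in> X) \<and>
     depends n X \<and> (\<exists>D. finite D \<and> D \<subseteq> carrier G \<and> glues D X)"

text \<open>Enlarging the gluing distance is harmless by \<open>glues_mono\<close>, so the identity
  and all inverses may be added.\<close>

lemma flexible_symmetric_glues:
  assumes "flexible n X"
  obtains D where "finite D" "D \<subseteq> carrier G" "\<one> \<in> D" "set_inv D = D" "glues D X"
proof -
  obtain D where D: "finite D" "D \<subseteq> carrier G" "glues D X"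
    using assms by (auto simp: flexible_def)
  define D' where "D' = insert \<one> (D \<union> set_inv D)"
  have "set_inv D' = D'"
    using D(2) unfolding D'_def SET_INV_def by (auto simp: image_iff subset_iff)
  moreover have "finite D'" "D' \<subseteq> carrier G"
    using D(1) finite_set_inv D(2) set_inv_closed[OF D(2)] by (auto simp: D'_def)
  moreover have "glues D' X" using D(3) by (rule glues_mono) (auto simp: D'_def)
  ultimately show thesis by (intro that[of D']) (simp_all add: D'_def)
qed

text \<open>Base case: the full shift has no constraints, so each point of \<open>P\<close> can copy
  its own configuration.\<close>

lemma flexible_config: "flexible 0 (topspace config)"
proof -
  have "glues {\<one>} (topspace config)"
    unfolding glues_def
  proof (intro allI impI)
    fix P and \<xi> :: "'a \<Rightarrow> 'a \<times> nat \<Rightarrow> nat"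
    assume P: "P \<subseteq> carrier G" and \<xi>: "\<xi> \<in> P \<rightarrow> topspace config"
    \<comment> \<open>The colour \<open>0\<close> is an arbitrary filler off
      \<open>P\<close>.\<close>
    define z where "z = (\<lambda>(t, j)\<in>carrier G \<times> UNIV. if t \<in> P then \<xi> t (t, j) else 0)"
    have "z \<in> topspace config"
      using P \<xi> config_less by (auto simp: topspace_config z_def Pi_iff)
    then show "\<exists>z\<in>topspace config. \<forall>t\<in>P. \<forall>j. z (t, j) = \<xi> t (t, j)"
      using P by (intro bexI[of _ z]) (auto simp: z_def)
  qed
  then show ?thesis
    by (auto simp: flexible_def depends_def shift_closed)
qed

text \<open>Layer \<open>n\<close> is unconstrained in \<open>X\<close>, so after gluing in
  \<open>X\<close> it can be replaced by a proper colouring that extends the prescribed colours. For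
  the identity no proper colouring exists, and the set stays as it is.\<close>

lemma flexible_colour_layer:
  assumes X: "flexible n X" and g: "g \<in> carrier G"
  defines "X' \<equiv> {x \<in> X. g \<noteq> \<one> \<longrightarrow> (\<forall>h\<in>carrier G. x (h, n) \<noteq> x (h \<otimes> g, n))}"
  shows "flexible (Suc n) X'"
proof (cases "g = \<one>")
  case True
  then show ?thesis
    using X unfolding X'_def flexible_def depends_def by (simp; metis less_Suc_eq)
next
  case False
  obtain D where D: "finite D" "D \<subseteq> carrier G" "glues D X"
    and Xc: "X \<subseteq> topspace config" and Xs: "\<And>g x. g \<in> carrier G \<Longrightarrow> x \<in> X \<Longrightarrow> shift g x \<in> X"
    and Xd: "depends n X"
    using X unfolding flexible_def by blast
  \<comment> \<open>With \<open>g\<close> in the gluing distance, neighbours \<open>h\<close> and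
    \<open>h \<otimes> g\<close> in \<open>P\<close> imitate the same properly coloured
    configuration, so the colours prescribed on \<open>P\<close> are proper.\<close>
  have "glues (insert g D) X'"
    unfolding glues_def
  proof (intro allI impI)
    fix P and \<xi> :: "'a \<Rightarrow> 'a \<times> nat \<Rightarrow> nat"
    assume P: "P \<subseteq> carrier G" and \<xi>: "\<xi> \<in> P \<rightarrow> X'"
      and eq: "\<forall>s\<in>P. \<forall>t\<in>P. near (insert g D) s t \<longrightarrow> \<xi> s = \<xi> t"
    have \<xi>X: "\<xi> t \<in> X" and \<xi>c: "\<xi> t \<in> topspace config" if "t \<in> P" for t
      using \<xi> that Xc by (auto simp: X'_def)
    have "\<exists>z\<in>X. \<forall>t\<in>P. \<forall>j. z (t, j) = \<xi> t (t, j)"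
    proof (rule gluesD[OF D(3) P, of \<xi>])
      show "\<xi> s = \<xi> t" if "s \<in> P" "t \<in> P" "near D s t" for s t
        using eq that(1,2) near_mono[OF that(3), of "insert g D"] by auto
    qed (rule \<xi>X)
    then obtain z where z: "z \<in> X" "\<forall>t\<in>P. \<forall>j. z (t, j) = \<xi> t (t, j)" by (elim bexE)
    have "\<exists>c. c \<in> carrier G \<rightarrow> {..<3} \<and> (\<forall>h\<in>P. c h = \<xi> h (h, n)) \<and>
      (\<forall>h\<in>carrier G. c h \<noteq> c (h \<otimes> g))"
    proof (rule proper_colouring_extension[OF g False P, of "\<lambda>h. \<xi> h (h, n)"])
      show "(\<lambda>h. \<xi> h (h, n)) \<in> P \<rightarrow> {..<3}"
        using \<xi>c P config_less by auto
      show "\<xi> h (h, n) \<noteq> \<xi> (h \<otimes> g) (h \<otimes> g, n)" if h: "h \<in> P" "h \<otimes> g \<in> P" for h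
      proof -
        have "inv h \<otimes> (h \<otimes> g) = g" using h(1) P g by (auto simp flip: m_assoc)
        then have "\<xi> h = \<xi> (h \<otimes> g)" using eq h by (auto simp: near_def)
        moreover have "\<xi> h \<in> X'" using \<xi> h by auto
        ultimately show ?thesis using False h(1) P unfolding X'_def by auto
      qed
    qed
    then obtain c where c: "c \<in> carrier G \<rightarrow> {..<3}" "\<forall>h\<in>P. c h = \<xi> h (h, n)"
      "\<forall>h\<in>carrier G. c h \<noteq> c (h \<otimes> g)" by (elim exE conjE)
    define y where "y = (\<lambda>(h, j)\<in>carrier G \<times> UNIV. if j = n then c h else z (h, j))"
    have y: "y (h, j) = (if j = n then c h else z (h, j))" if "h \<in> carrier G" for h j
      using that by (simp add: y_def)
    have "y \<in> topspace config"
      using c(1) z(1) Xc config_less by (auto simp: topspace_config y_def Pi_iff)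
    moreover have "\<forall>h\<in>carrier G. \<forall>j<n. y (h, j) = z (h, j)" using y by auto
    ultimately have "y \<in> X" using Xd z(1) unfolding depends_def by blast
    then have "y \<in> X'" using c(3) g by (auto simp: X'_def y)
    moreover have "y (t, j) = \<xi> t (t, j)" if "t \<in> P" for t j
      using that P y z(2) c(2) by auto
    ultimately show "\<exists>z\<in>X'. \<forall>t\<in>P. \<forall>j. z (t, j) = \<xi> t (t, j)" by blast
  qed
  \<comment> \<open>The colouring condition uses right translation by \<open>g\<close>, which
    commutes with the left shift.\<close>
  moreover have "shift a x \<in> X'" if "a \<in> carrier G" "x \<in> X'" for a x
    using that g Xs[of a x] unfolding X'_def by (auto simp: shift_apply simp flip: m_assoc)
  moreover have "depends (Suc n) X'"
    unfolding depends_def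
  proof (intro ballI impI)
    fix x y assume xy: "x \<in> X'" "y \<in> topspace config" "\<forall>h\<in>carrier G. \<forall>j<Suc n. y (h, j) = x (h, j)"
    then have "y \<in> X" using Xd unfolding depends_def X'_def by (simp add: less_Suc_eq) blast
    then show "y \<in> X'" using xy g by (auto simp: X'_def)
  qed
  moreover have "X' \<subseteq> topspace config" using Xc by (auto simp: X'_def)
  moreover have "finite (insert g D)" "insert g D \<subseteq> carrier G" using D g by auto
  ultimately show ?thesis unfolding flexible_def by blast
qed

section \<open>Marker sets carrying a pattern\<close>

definition marked ::
  "'a set \<Rightarrow> 'a set \<Rightarrow> ('a \<times> nat \<Rightarrow> nat) \<Rightarrow> nat \<Rightarrow> ('a \<times> nat \<Rightarrow> nat) \<Rightarrow> 'a set \<Rightarrow> bool" where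
  "marked V B q n x S \<longleftrightarrow> maxsep V S \<and>
     (\<forall>s\<in>S. \<forall>t\<in>carrier G. near B s t \<longrightarrow> (\<forall>j<n. x (t, j) = shift s q (t, j)))"

lemma markedD:
  "marked V B q n x S \<Longrightarrow> s \<in> S \<Longrightarrow> t \<in> carrier G \<Longrightarrow> near B s t \<Longrightarrow> j < n \<Longrightarrow>
    x (t, j) = shift s q (t, j)"
  by (auto simp: marked_def)

text \<open>The last inclusion makes the windows (translates of \<open>B\<close>) of distinct
  markers \<open>D\<close>-apart, so copies of \<open>q\<close> can be prescribed at all of them at
  once inside \<open>X\<close>. Near \<open>P\<close> the markers are those of the imitated
  configuration, which shows \<open>q\<close> there already.\<close>

lemma glues_marked:
  assumes D: "finite D" "D \<subseteq> carrier G" "\<one> \<in> D" "set_inv D = D" "glues D X"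
    and inv: "\<And>g x. g \<in> carrier G \<Longrightarrow> x \<in> X \<Longrightarrow> shift g x \<in> X"
    and B: "finite B" "B \<subseteq> carrier G" and q: "q \<in> X"
    and V: "finite V" "V \<subseteq> carrier G" "\<one> \<in> V" "set_inv V = V" "B <#> (D <#> set_inv B) \<subseteq> V"
  obtains D' where "finite D'" "D' \<subseteq> carrier G" "glues D' {x \<in> X. \<exists>S. marked V B q n x S}"
proof -
  define Bi where "Bi = set_inv B"
  \<comment> \<open>\<open>M1\<close> bounds the distance from a point of \<open>P\<close> to a
    marker whose window comes \<open>D\<close>-near it; \<open>M\<close> allows one more
    \<open>V\<close>-step. The three parts of \<open>D'\<close> serve, in order, gluing in
    \<open>X\<close>, separation of \<open>S0\<close>, and agreement of all points touching one
    window.\<close>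
  define M1 where "M1 = D <#> Bi"
  define M where "M = M1 <#> V"
  define D' where "D' = D \<union> (M <#> (V <#> set_inv M)) \<union> (M1 <#> (B <#> D))"
  have fin: "finite Bi" "finite M" "finite D'"
    using D(1) B(1) V(1) by (simp_all add: D'_def M_def M1_def Bi_def finite_set_mult finite_set_inv)
  have cG: "Bi \<subseteq> carrier G" "M1 \<subseteq> carrier G" "M \<subseteq> carrier G" "D' \<subseteq> carrier G"
    using D(2) B(2) V(2) by (simp_all add: D'_def M_def M1_def Bi_def set_mult_closed set_inv_closed)
  let ?X' = "{x \<in> X. \<exists>S. marked V B q n x S}"
  \<comment> \<open>The marker set is chosen from the configuration alone, so points imitating the
    same configuration retain the same markers.\<close>
  define Sf where "Sf x = (SOME S. marked V B q n x S)" for x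
  have Sf: "marked V B q n x (Sf x)" if "x \<in> ?X'" for x
    using that unfolding Sf_def by (auto intro: someI)
  have "glues D' ?X'"
    unfolding glues_def
  proof (intro allI impI)
    fix P and \<xi> :: "'a \<Rightarrow> 'a \<times> nat \<Rightarrow> nat"
    assume P: "P \<subseteq> carrier G" and \<xi>: "\<xi> \<in> P \<rightarrow> ?X'"
      and eq: "\<forall>s\<in>P. \<forall>t\<in>P. near D' s t \<longrightarrow> \<xi> s = \<xi> t"
    have PG: "h \<in> carrier G" if "h \<in> P" for h using that P by auto
    have \<xi>X: "\<xi> h \<in> X" and \<xi>m: "marked V B q n (\<xi> h) (Sf (\<xi> h))" if "h \<in> P" for h
      using \<xi> that Sf by auto
    have SfG: "Sf (\<xi> h) \<subseteq> carrier G" if "h \<in> P" for h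
      using \<xi>m[OF that] by (simp add: marked_def maxsep_def)
    (* Each \<xi> h keeps its own marker set near h; the rest is filled in by maximality, and the pattern q
       is placed at all markers whose window no h \<in> P touches. *)
    define S0 where "S0 = {s \<in> carrier G. \<exists>h\<in>P. s \<in> Sf (\<xi> h) \<and> near M h s}"
    \<comment> \<open>\<open>V\<close>-near points of \<open>S0\<close> come from
      \<open>D'\<close>-near points of \<open>P\<close>, hence from one configuration and its
      separated marker set.\<close>
    have "s = t" if st: "s \<in> S0" "t \<in> S0" "near V s t" for s t
    proof -
      obtain h k where hk: "h \<in> P" "s \<in> Sf (\<xi> h)" "near M h s" "k \<in> P" "t \<in> Sf (\<xi> k)" "near M k t"
        using st by (auto simp: S0_def)
      have G: "s \<in> carrier G" "t \<in> carrier G" "h \<in> carrier G" "k \<in> carrier G"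
        using st hk PG by (auto simp: S0_def)
      have "near (M <#> (V <#> set_inv M)) h k"
        by (intro near_trans[OF hk(3) near_trans[OF st(3) near_sym[OF hk(6)]]] G)
      then have "\<xi> h = \<xi> k" using eq hk near_mono[of _ h k D'] unfolding D'_def by blast
      then show ?thesis
        using \<xi>m[OF hk(1)] hk st(3) by (auto simp: marked_def maxsep_def)
    qed
    then obtain S where S: "maxsep V S" "S0 \<subseteq> S"
      using maxsep_extension[OF V(3,4), of S0] unfolding S0_def by blast
    have SG: "s \<in> carrier G" if "s \<in> S" for s using S(1) that by (auto simp: maxsep_def)
    \<comment> \<open>Maximality of \<open>Sf (\<xi> h)\<close> gives a marker \<open>s'\<close>
      that is \<open>V\<close>-near \<open>s\<close>. It is within \<open>M\<close> of
      \<open>h\<close>, hence retained in \<open>S\<close>, and separation of \<open>S\<close>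
      forces \<open>s = s'\<close>.\<close>
    have local: "s \<in> Sf (\<xi> h)" if s: "s \<in> S" "h \<in> P" "near M1 h s" for s h
    proof -
      obtain s' where s': "s' \<in> Sf (\<xi> h)" "near V s s'"
        using \<xi>m[OF s(2)] SG[OF s(1)] by (auto simp: marked_def maxsep_def)
      then have "near M h s'"
        using near_trans[OF s(3) s'(2)] SG s PG SfG[OF s(2)] unfolding M_def by blast
      then have "s' \<in> S" using S(2) s' s(2) SfG[OF s(2)] by (auto simp: S0_def)
      then have "s = s'" using S(1) s(1) s'(2) by (auto simp: maxsep_def)
      then show ?thesis using s' by simp
    qed
    define touched where "touched s h \<longleftrightarrow> h \<in> P \<and> (\<exists>t\<in>carrier G. near D h t \<and> near B s t)" for s h
    have touched_near: "near M1 h s" if "touched s h" "s \<in> carrier G" for s h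
      using that near_trans[OF _ near_sym] PG unfolding touched_def M1_def Bi_def by blast
    have touched_eq: "\<xi> h = \<xi> k" if hk: "touched s h" "touched s k" "s \<in> carrier G" for s h k
    proof -
      obtain t where t: "t \<in> carrier G" "near D k t" "near B s t" and k: "k \<in> P"
        using hk by (auto simp: touched_def)
      have "near (B <#> D) s k"
        using near_trans[OF t(3) near_sym[OF t(2)]] t(1) k PG hk(3) D(4) by auto
      then have "near (M1 <#> (B <#> D)) h k"
        using near_trans[OF touched_near[OF hk(1,3)]] hk k PG by (auto simp: touched_def)
      then show ?thesis
        using eq hk near_mono[of _ h k D'] unfolding D'_def touched_def by blast
    qed
    \<comment> \<open>The configuration to imitate on the window of \<open>s\<close>. By
      \<open>touched_eq\<close> it does not matter which touching point is chosen.\<close>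
    define \<eta> where "\<eta> s = (if \<exists>h. touched s h then \<xi> (SOME h. touched s h) else shift s q)" for s
    have \<eta>_touched: "\<eta> s = \<xi> h" if "touched s h" "s \<in> carrier G" for s h
    proof -
      have "touched s (SOME h. touched s h)" using that(1) by (rule someI)
      then have "\<xi> (SOME h. touched s h) = \<xi> h" by (rule touched_eq[OF _ that])
      moreover have "\<exists>h. touched s h" using that(1) by (rule exI)
      ultimately show ?thesis by (simp add: \<eta>_def)
    qed
    have \<eta>X: "\<eta> s \<in> X" if "s \<in> S" for s
    proof (cases "\<exists>h. touched s h")
      case True
      then obtain h where h: "touched s h" by blast
      then have "\<xi> h \<in> X" using \<xi>X by (simp add: touched_def)
      then show ?thesis using \<eta>_touched[OF h SG[OF that]] by simp
    next
      case False
      then show ?thesis using inv[OF SG[OF that] q] by (simp add: \<eta>_def)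
    qed
    define W where "W = {t \<in> carrier G. \<exists>s\<in>S. near B s t}"
    define c where "c t = (SOME s. s \<in> S \<and> near B s t)" for t
    have c: "c t \<in> S" "near B (c t) t" if "t \<in> W" for t
      using that someI_ex[of "\<lambda>s. s \<in> S \<and> near B s t"] unfolding W_def c_def by auto
    \<comment> \<open>Windows of distinct markers are \<open>D\<close>-apart. Taken with
      \<open>t = t'\<close>, this shows that \<open>c t\<close> is the only marker whose window
      contains \<open>t\<close>.\<close>
    have window_eq: "s = s'"
      if "s \<in> S" "s' \<in> S" "near B s t" "near B s' t'" "near D t t'" "t \<in> carrier G" "t' \<in> carrier G"
      for s s' t t'
    proof -
      have "near (B <#> (D <#> set_inv B)) s s'"
        using that SG by (intro near_trans[OF that(3) near_trans[OF that(5) near_sym[OF that(4)]]]) auto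
      then have "near V s s'" using V(5) by (rule near_mono)
      then show ?thesis using S(1) that by (auto simp: maxsep_def)
    qed
    \<comment> \<open>On the overlap both choices agree, because a point of \<open>P\<close> inside
      a window touches it.\<close>
    define \<zeta> where "\<zeta> t = (if t \<in> P then \<xi> t else \<eta> (c t))" for t
    have \<zeta>_mixed: "\<xi> s = \<eta> (c t)" if "s \<in> P" "t \<in> W" "near D s t" for s t
    proof -
      have "touched (c t) s"
        using c[OF that(2)] that unfolding touched_def W_def by blast
      then show ?thesis using \<eta>_touched SG[OF c(1)[OF that(2)]] by simp
    qed
    have "\<exists>z\<in>X. \<forall>t\<in>P \<union> W. \<forall>j. z (t, j) = \<zeta> t (t, j)"
    proof (rule gluesD[OF D(5), of "P \<union> W" \<zeta>])
      show "P \<union> W \<subseteq> carrier G" using P by (auto simp: W_def)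
      show "\<zeta> t \<in> X" if "t \<in> P \<union> W" for t
        using that \<xi>X \<eta>X c by (auto simp: \<zeta>_def)
      show "\<zeta> s = \<zeta> t" if st: "s \<in> P \<union> W" "t \<in> P \<union> W" "near D s t" for s t
      proof -
        have G: "s \<in> carrier G" "t \<in> carrier G" using st P by (auto simp: W_def)
        have sym: "near D t s" using near_sym[OF st(3) G] D(4) by simp
        consider "s \<in> P" "t \<in> P" | "s \<in> P" "t \<notin> P" "t \<in> W" | "s \<notin> P" "s \<in> W" "t \<in> P"
          | "s \<notin> P" "s \<in> W" "t \<notin> P" "t \<in> W" using st by blast
        then show ?thesis
        proof cases
          case 1
          then show ?thesis
            using eq near_mono[OF st(3), of D'] unfolding \<zeta>_def D'_def by auto
        next
          case 2
          then show ?thesis using \<zeta>_mixed[of s t] st by (simp add: \<zeta>_def)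
        next
          case 3
          then show ?thesis using \<zeta>_mixed[of t s] sym by (simp add: \<zeta>_def)
        next
          case 4
          then have "c s = c t"
            using window_eq[of "c s" "c t" s t] c st(3) G by blast
          then show ?thesis using 4 by (simp add: \<zeta>_def)
        qed
      qed
    qed
    then obtain z where z: "z \<in> X" "\<And>t j. t \<in> P \<union> W \<Longrightarrow> z (t, j) = \<zeta> t (t, j)" by auto
    \<comment> \<open>In a touched window \<open>z\<close> copies some \<open>\<xi> h\<close>, and
      by \<open>local\<close> the point \<open>s\<close> is a marker of \<open>\<xi> h\<close>, so
      the pattern is present. In an untouched window \<open>z\<close> copies the translate of
      \<open>q\<close>.\<close>
    have "z (t, j) = shift s q (t, j)" if t: "s \<in> S" "t \<in> carrier G" "near B s t" "j < n" for s t j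
    proof -
      have tW: "t \<in> W" using t by (auto simp: W_def)
      have near_t: "near D t t" using near_refl[OF D(3) t(2)] .
      show ?thesis
      proof (cases "\<exists>h. touched s h")
        case True
        then obtain h where h: "touched s h" by blast
        have hP: "h \<in> P" using h by (simp add: touched_def)
        have "\<zeta> t = \<xi> h"
        proof (cases "t \<in> P")
          case True
          then have "touched s t" using t near_t by (auto simp: touched_def)
          then show ?thesis using touched_eq[OF h _ SG[OF t(1)]] True by (auto simp: \<zeta>_def)
        next
          case False
          have "c t = s" using window_eq[of "c t" s t t] c[OF tW] t near_t by blast
          then show ?thesis using False \<eta>_touched[OF h SG[OF t(1)]] by (simp add: \<zeta>_def)
        qed
        moreover have "s \<in> Sf (\<xi> h)" using local[OF t(1) hP] touched_near[OF h SG[OF t(1)]] by blast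
        ultimately show ?thesis using z(2)[of t j] tW markedD[OF \<xi>m[OF hP]] t by simp
      next
        case False
        then have "t \<notin> P" using t near_t by (auto simp: touched_def)
        moreover have "c t = s" using window_eq[of "c t" s t t] c[OF tW] t near_t by blast
        ultimately have "\<zeta> t = shift s q" using False by (simp add: \<zeta>_def \<eta>_def)
        then show ?thesis using z(2)[of t j] tW by simp
      qed
    qed
    then have "marked V B q n z S" using S(1) by (auto simp: marked_def)
    then show "\<exists>z\<in>?X'. \<forall>t\<in>P. \<forall>j. z (t, j) = \<xi> t (t, j)"
      using z by (intro bexI[of _ z]) (auto simp: \<zeta>_def)
  qed
  then show thesis using that fin(3) cG(4) by blast
qed


section \<open>Universal patterns and recurrence along a normal subgroup\<close>

lemma set_inv_Un_set_inv:
  assumes "A \<subseteq> carrier G"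
  shows "set_inv (A \<union> set_inv A) = A \<union> set_inv A"
  using assms unfolding SET_INV_def by (auto simp: image_iff subset_iff)

lemma marked_shift:
  assumes m: "marked V B q n x S" and g: "g \<in> carrier G"
  shows "marked V B q n (shift g x) ((\<otimes>) g ` S)"
proof -
  have S: "maxsep V S" and SG: "s \<in> carrier G" if "s \<in> S" for s
    using m that by (auto simp: marked_def maxsep_def)
  have "shift g x (t, j) = shift (g \<otimes> s) q (t, j)"
    if "s \<in> S" "t \<in> carrier G" "near B (g \<otimes> s) t" "j < n" for s t j
  proof -
    have "x (inv g \<otimes> t, j) = shift s q (inv g \<otimes> t, j)"
      using markedD[OF m that(1), of "inv g \<otimes> t" j] that g near_shift SG by auto
    then show ?thesis
      using that g SG by (simp add: shift_apply inv_mult_group m_assoc)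
  qed
  moreover have "maxsep V ((\<otimes>) g ` S)"
    using m g by (simp add: marked_def maxsep_shift)
  ultimately show ?thesis
    unfolding marked_def by blast
qed

text \<open>Only finitely many patterns exist on \<open>E\<close> and the first \<open>n\<close>
  layers. A representative of each is moved by its own element of \<open>N\<close>, far enough apart
  for gluing to put all of them into one \<open>q\<close>.\<close>

lemma universal_pattern:
  assumes X: "flexible n X" and N: "subgroup N G" "infinite N"
    and E: "finite E" "E \<subseteq> carrier G"
  obtains q F where "q \<in> X" "finite F" "F \<subseteq> N"
    "\<forall>x\<in>X. \<exists>d\<in>F. \<forall>e\<in>E. \<forall>j<n. q (d \<otimes> e, j) = x (e, j)"
proof -
  interpret N: subgroup N G by (rule N(1))
  have Xc: "X \<subseteq> topspace config" and Xs: "\<And>g x. g \<in> carrier G \<Longrightarrow> x \<in> X \<Longrightarrow> shift g x \<in> X"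
    using X by (auto simp: flexible_def)
  obtain D where D: "finite D" "D \<subseteq> carrier G" "\<one> \<in> D" "set_inv D = D" "glues D X"
    using X by (rule flexible_symmetric_glues)
  define pat where "pat x = restrict x (E \<times> {..<n})" for x :: "'a \<times> nat \<Rightarrow> nat"
  have "pat ` X \<subseteq> (E \<times> {..<n}) \<rightarrow>\<^sub>E {..<3}"
    using Xc config_less E by (force simp: pat_def)
  moreover have "finite ((E \<times> {..<n}) \<rightarrow>\<^sub>E {..<3::nat})" using E by (intro finite_PiE) auto
  ultimately have "finite (pat ` X)" by (rule finite_subset)
  from finite_subset_image[OF this subset_refl] obtain R
    where R: "R \<subseteq> X" "finite R" "pat ` X = pat ` R" by auto
  \<comment> \<open>Base points that are \<open>W\<close>-apart have \<open>D\<close>-apart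
    translates of \<open>E\<close>.\<close>
  define W where "W = E <#> (D <#> set_inv E)"
  have W: "finite W" "W \<subseteq> carrier G"
    using D(1,2) E by (simp_all add: W_def finite_set_mult finite_set_inv set_mult_closed set_inv_closed)
  obtain \<delta> where \<delta>: "\<delta> \<in> R \<rightarrow> N" "\<And>r r'. r \<in> R \<Longrightarrow> r' \<in> R \<Longrightarrow> near W (\<delta> r) (\<delta> r') \<Longrightarrow> r = r'"
    using spread_translates[OF N R(2) W] by metis
  have \<delta>G: "\<delta> r \<in> carrier G" if "r \<in> R" for r using \<delta>(1) that N.subset by auto
  define B where "B = {t \<in> carrier G. \<exists>r\<in>R. near E (\<delta> r) t}"
  \<comment> \<open>The representative whose translate of \<open>E\<close> contains
    \<open>t\<close>; it is unique by \<open>\<rho>_eq\<close> with \<open>t = t'\<close>.\<close>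
  define \<rho> where "\<rho> t = (SOME r. r \<in> R \<and> near E (\<delta> r) t)" for t
  have \<rho>: "\<rho> t \<in> R" "near E (\<delta> (\<rho> t)) t" if "t \<in> B" for t
    using that someI_ex[of "\<lambda>r. r \<in> R \<and> near E (\<delta> r) t"] unfolding B_def \<rho>_def by auto
  have \<rho>_eq: "r = r'"
    if "r \<in> R" "r' \<in> R" "near E (\<delta> r) t" "near E (\<delta> r') t'" "near D t t'" "t \<in> carrier G" "t' \<in> carrier G"
    for r r' t t'
  proof -
    have "near W (\<delta> r) (\<delta> r')"
      unfolding W_def using that \<delta>G
      by (intro near_trans[OF that(3) near_trans[OF that(5) near_sym[OF that(4)]]]) auto
    then show ?thesis using \<delta>(2) that by blast
  qed
  have "\<exists>q\<in>X. \<forall>t\<in>B. \<forall>j. q (t, j) = shift (\<delta> (\<rho> t)) (\<rho> t) (t, j)"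
  proof (rule gluesD[OF D(5)])
    show "B \<subseteq> carrier G" by (auto simp: B_def)
    show "shift (\<delta> (\<rho> t)) (\<rho> t) \<in> X" if "t \<in> B" for t
      using \<rho>(1)[OF that] R(1) \<delta>G Xs by blast
    show "shift (\<delta> (\<rho> s)) (\<rho> s) = shift (\<delta> (\<rho> t)) (\<rho> t)" if "s \<in> B" "t \<in> B" "near D s t" for s t
      using \<rho>_eq[of "\<rho> s" "\<rho> t" s t] \<rho>[OF that(1)] \<rho>[OF that(2)] that by (simp add: B_def)
  qed
  then obtain q where q: "q \<in> X" "\<And>t j. t \<in> B \<Longrightarrow> q (t, j) = shift (\<delta> (\<rho> t)) (\<rho> t) (t, j)" by auto
  have "q (\<delta> r \<otimes> e, j) = r (e, j)" if r: "r \<in> R" "e \<in> E" for r e j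
  proof -
    define t where "t = \<delta> r \<otimes> e"
    have e: "e \<in> carrier G" using E that by auto
    have inv: "inv (\<delta> r) \<otimes> t = e" using e \<delta>G[OF r(1)] by (simp add: t_def flip: m_assoc)
    have t: "t \<in> carrier G" "near E (\<delta> r) t"
      using e \<delta>G[OF r(1)] r inv by (simp_all add: near_def) (simp add: t_def)
    then have tB: "t \<in> B" using r by (auto simp: B_def)
    then have "\<rho> t = r"
      using \<rho>_eq[of "\<rho> t" r t t] \<rho>[OF tB] r t near_refl[OF D(3) t(1)] by simp
    then show ?thesis using q(2)[OF tB] t(1) inv by (simp add: shift_apply flip: t_def)
  qed
  moreover have "\<exists>r\<in>R. \<forall>e\<in>E. \<forall>j<n. r (e, j) = x (e, j)" if "x \<in> X" for x
  proof -
    have "pat x \<in> pat ` R" using R(3) that by blast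
    then obtain r where r: "r \<in> R" "pat r = pat x" by auto
    have "r (e, j) = x (e, j)" if "e \<in> E" "j < n" for e j
      using fun_cong[OF r(2), of "(e, j)"] that by (simp add: pat_def)
    then show ?thesis using r(1) by blast
  qed
  ultimately have "\<exists>d\<in>\<delta> ` R. \<forall>e\<in>E. \<forall>j<n. q (d \<otimes> e, j) = x (e, j)" if "x \<in> X" for x
    using that by (metis imageI)
  then show thesis using q(1) R(2) \<delta>(1) by (intro that[of q "\<delta> ` R"]) auto
qed

text \<open>Two steps inside \<open>N\<close> find the pattern of \<open>x\<close> in
  \<open>y\<close>: some \<open>s \<in> L\<close> is a marker of \<open>y\<close>, where
  \<open>y\<close> shows \<open>q\<close>, and some \<open>d \<in> F\<close> leads to the copy of
  the pattern inside \<open>q\<close>. Their product lies in the finite set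
  \<open>L <#> F\<close>.\<close>

lemma flexible_minimality:
  assumes X: "flexible n X" and N: "N \<lhd> G" "infinite N"
    and E: "finite E" "E \<subseteq> carrier G"
  obtains X' L where "flexible n X'" "X' \<subseteq> X" "finite L" "L \<subseteq> N"
    "\<forall>x\<in>X'. \<forall>y\<in>X'. \<exists>d\<in>L. \<forall>e\<in>E. \<forall>j<n. y (d \<otimes> e, j) = x (e, j)"
proof -
  interpret N: normal N G by (rule N(1))
  have Xc: "X \<subseteq> topspace config" and Xs: "\<And>g x. g \<in> carrier G \<Longrightarrow> x \<in> X \<Longrightarrow> shift g x \<in> X"
    and Xd: "depends n X"
    using X by (auto simp: flexible_def)
  obtain D where D: "finite D" "D \<subseteq> carrier G" "\<one> \<in> D" "set_inv D = D" "glues D X"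
    using X by (rule flexible_symmetric_glues)
  obtain q F where q: "q \<in> X" and F: "finite F" "F \<subseteq> N"
    and pat: "\<forall>x\<in>X. \<exists>d\<in>F. \<forall>e\<in>E. \<forall>j<n. q (d \<otimes> e, j) = x (e, j)"
    using universal_pattern[OF X N.subgroup_axioms N(2) E] .
  have FG: "F \<subseteq> carrier G" using F(2) N.subset by blast
  \<comment> \<open>The window must cover all translates of \<open>E\<close> by \<open>F\<close>, so
    that a single marker displays every pattern.\<close>
  define B where "B = F <#> E"
  have B: "finite B" "B \<subseteq> carrier G"
    using F(1) E FG by (simp_all add: B_def finite_set_mult set_mult_closed)
  \<comment> \<open>The separation of markers that \<open>glues_marked\<close> asks for.\<close>
  define U where "U = B <#> (D <#> set_inv B)"
  have U: "finite U" "U \<subseteq> carrier G"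
    using D(1,2) B by (simp_all add: U_def finite_set_mult finite_set_inv set_mult_closed set_inv_closed)
  obtain V where V: "finite V" "V \<subseteq> carrier G" "\<one> \<in> V" "set_inv V = V" "U \<union> set_inv U \<subseteq> V"
    and "\<exists>L. finite L \<and> L \<subseteq> N \<and> (\<forall>S. maxsep V S \<longrightarrow> S \<inter> L \<noteq> {})"
    using maxsep_meets_normal[OF N, of "U \<union> set_inv U"] U finite_set_inv set_inv_closed set_inv_Un_set_inv
    by (metis finite_Un Un_subset_iff)
  then obtain L where L: "finite L" "L \<subseteq> N" "\<And>S. maxsep V S \<Longrightarrow> S \<inter> L \<noteq> {}" by blast
  define X' where "X' = {x \<in> X. \<exists>S. marked V B q n x S}"
  have "B <#> (D <#> set_inv B) \<subseteq> V" using V(5) unfolding U_def by blast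
  then obtain D' where D': "finite D'" "D' \<subseteq> carrier G" "glues D' X'"
    unfolding X'_def using glues_marked[OF D Xs B q V(1-4), of n] by blast
  have "shift g x \<in> X'" if "g \<in> carrier G" "x \<in> X'" for g x
    using that Xs marked_shift unfolding X'_def by blast
  moreover have "depends n X'"
    unfolding depends_def
  proof (intro ballI impI)
    fix x y assume x: "x \<in> X'" and y: "y \<in> topspace config"
      and eq: "\<forall>h\<in>carrier G. \<forall>j<n. y (h, j) = x (h, j)"
    have "y \<in> X" using x y eq Xd unfolding X'_def depends_def by blast
    moreover obtain S where "marked V B q n x S" using x by (auto simp: X'_def)
    \<comment> \<open>The markers are not part of the configuration and only the first
      \<open>n\<close> layers are compared, so \<open>S\<close> serves \<open>y\<close> as
      well.\<close>
    then have "marked V B q n y S" using eq by (auto simp: marked_def)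
    ultimately show "y \<in> X'" by (auto simp: X'_def)
  qed
  moreover have "X' \<subseteq> X" by (auto simp: X'_def)
  ultimately have flex: "flexible n X'"
    using D' Xc unfolding flexible_def by blast
  have "\<exists>d\<in>L <#> F. \<forall>e\<in>E. \<forall>j<n. y (d \<otimes> e, j) = x (e, j)" if xy: "x \<in> X'" "y \<in> X'" for x y
  proof -
    obtain S where S: "marked V B q n y S" using xy by (auto simp: X'_def)
    then obtain s where s: "s \<in> S" "s \<in> L"
      using L(3)[of S] unfolding marked_def by blast
    obtain d where d: "d \<in> F" "\<forall>e\<in>E. \<forall>j<n. q (d \<otimes> e, j) = x (e, j)"
      using pat xy by (auto simp: X'_def)
    have G: "s \<in> carrier G" "d \<in> carrier G" using s L(2) N.subset d FG by auto
    have "y (s \<otimes> d \<otimes> e, j) = x (e, j)" if e: "e \<in> E" "j < n" for e j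
    proof -
      have eG: "e \<in> carrier G" using e E by auto
      have inv: "inv s \<otimes> (s \<otimes> d \<otimes> e) = d \<otimes> e" using G eG by (simp add: m_assoc flip: m_assoc[of "inv s" s])
      then have "near B s (s \<otimes> d \<otimes> e)"
        using d(1) e(1) unfolding near_def B_def set_mult_def by auto
      then have "y (s \<otimes> d \<otimes> e, j) = shift s q (s \<otimes> d \<otimes> e, j)"
        using markedD[OF S s(1)] G eG e(2) by simp
      also have "\<dots> = x (e, j)" using G eG inv d(2) e by (simp add: shift_apply)
      finally show ?thesis .
    qed
    moreover have "s \<otimes> d \<in> L <#> F" using s d by (auto simp: set_mult_def)
    ultimately show ?thesis by blast
  qed
  moreover have "finite (L <#> F)" "L <#> F \<subseteq> N"
    using L F by (auto simp: finite_set_mult set_mult_def)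
  ultimately show thesis using that[OF flex] by (auto simp: X'_def)
qed

end

subsection \<open>Flows\<close>

text \<open>With a discrete first factor, the preimage of an open set is a union of open slices, one
  for each \<open>a \<in> A\<close>.\<close>

lemma continuous_map_prod_discrete:
  assumes "\<And>a. a \<in> A \<Longrightarrow> continuous_map X Y (\<lambda>x. F (a, x))"
  shows "continuous_map (prod_topology (discrete_topology A) X) Y F"
  unfolding continuous_map_def
proof (intro conjI allI impI)
  show "F \<in> topspace (prod_topology (discrete_topology A) X) \<rightarrow> topspace Y"
    using assms by (force simp: continuous_map_def)
  fix U assume U: "openin Y U"
  have "{p \<in> topspace (prod_topology (discrete_topology A) X). F p \<in> U} =
      (\<Union>a\<in>A. {a} \<times> {x \<in> topspace X. F (a, x) \<in> U})"
    by auto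
  moreover have "openin (prod_topology (discrete_topology A) X) ({a} \<times> {x \<in> topspace X. F (a, x) \<in> U})"
    if "a \<in> A" for a
    using that openin_continuous_map_preimage[OF assms[OF that] U] by (simp add: openin_prod_Times_iff)
  ultimately show "openin (prod_topology (discrete_topology A) X)
      {p \<in> topspace (prod_topology (discrete_topology A) X). F p \<in> U}"
    by auto
qed

text \<open>\<open>BijGroup\<close> consists of extensional bijections, whence the assumption
  \<open>ext\<close> and the restrictions in the actions below. The inverse group element supplies
  the inverse map.\<close>

lemma (in group) group_actionI:
  assumes closed: "\<And>g x. g \<in> carrier G \<Longrightarrow> x \<in> E \<Longrightarrow> \<phi> g x \<in> E"
    and ext: "\<And>g. g \<in> carrier G \<Longrightarrow> \<phi> g \<in> extensional E"
    and one: "\<And>x. x \<in> E \<Longrightarrow> \<phi> \<one> x = x"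
    and mult: "\<And>g h x. g \<in> carrier G \<Longrightarrow> h \<in> carrier G \<Longrightarrow> x \<in> E \<Longrightarrow> \<phi> (g \<otimes> h) x = \<phi> g (\<phi> h x)"
  shows "group_action G E \<phi>"
proof -
  have Bij: "\<phi> g \<in> Bij E" if g: "g \<in> carrier G" for g
  proof -
    have "bij_betw (\<phi> g) E E"
      using g closed mult[of "inv g" g] mult[of g "inv g"] one
      by (intro bij_betwI[of _ _ _ "\<phi> (inv g)"]) auto
    then show ?thesis using ext[OF g] by (simp add: Bij_def)
  qed
  have "\<phi> (g \<otimes> h) = compose E (\<phi> g) (\<phi> h)" if "g \<in> carrier G" "h \<in> carrier G" for g h
    using that mult ext[of "g \<otimes> h"]
    by (intro extensionalityI[of _ E]) (auto simp: compose_def)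
  then have "\<phi> \<in> hom G (BijGroup E)"
    using Bij by (auto simp: hom_def BijGroup_def)
  then show ?thesis
    unfolding group_action_def by (intro group_hom.intro group_hom_axioms.intro is_group group_BijGroup)
qed

section \<open>Transport of flows along a homeomorphism\<close>

definition transport_action :: "'y topology \<Rightarrow> ('x \<Rightarrow> 'y) \<Rightarrow> ('y \<Rightarrow> 'x) \<Rightarrow> ('g \<Rightarrow> 'x \<Rightarrow> 'x) \<Rightarrow> 'g \<Rightarrow> 'y \<Rightarrow> 'y" where
  "transport_action Y f f' \<phi> g = (\<lambda>y\<in>topspace Y. f (\<phi> g (f' y)))"

context
  fixes X :: "'x topology" and Y :: "'y topology" and f f'
  assumes hom: "homeomorphic_maps X Y f f'"
begin

lemma homeo_closed: "x \<in> topspace X \<Longrightarrow> f x \<in> topspace Y" "y \<in> topspace Y \<Longrightarrow> f' y \<in> topspace X"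
  and homeo_inverse: "x \<in> topspace X \<Longrightarrow> f' (f x) = x" "y \<in> topspace Y \<Longrightarrow> f (f' y) = y"
  and homeo_continuous: "continuous_map X Y f" "continuous_map Y X f'"
  using hom by (auto simp: homeomorphic_maps_def continuous_map_def Pi_iff)

lemma flow_transport:
  assumes "flow G X \<phi>"
  shows "flow G Y (transport_action Y f f' \<phi>)"
proof -
  interpret group_action G "topspace X" \<phi> using assms by (simp add: flow_def)
  interpret G: group G using group_hom by (rule group_hom.axioms(1))
  have closed: "\<phi> g x \<in> topspace X" if "g \<in> carrier G" "x \<in> topspace X" for g x
    using that element_image by blast
  have "group_action G (topspace Y) (transport_action Y f f' \<phi>)"
  proof (rule G.group_actionI)
    show "transport_action Y f f' \<phi> \<one>\<^bsub>G\<^esub> y = y" if "y \<in> topspace Y" for y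
      using that homeo_closed homeo_inverse id_eq_one by (simp add: transport_action_def flip: id_eq_one)
    show "transport_action Y f f' \<phi> (g \<otimes>\<^bsub>G\<^esub> h) y = transport_action Y f f' \<phi> g (transport_action Y f f' \<phi> h y)"
      if "g \<in> carrier G" "h \<in> carrier G" "y \<in> topspace Y" for g h y
      using that homeo_closed homeo_inverse closed composition_rule by (simp add: transport_action_def)
  qed (use homeo_closed closed in \<open>auto simp: transport_action_def\<close>)
  moreover have "continuous_map (prod_topology (discrete_topology (carrier G)) Y) Y
      (\<lambda>(g, y). transport_action Y f f' \<phi> g y)"
  proof (rule continuous_map_prod_discrete)
    fix g assume g: "g \<in> carrier G"
    have "continuous_map (prod_topology (discrete_topology (carrier G)) X) X (\<lambda>(g, x). \<phi> g x)"
      using assms by (simp add: flow_def)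
    moreover have "continuous_map X (prod_topology (discrete_topology (carrier G)) X) (\<lambda>x. (g, x))"
      using g by (simp add: continuous_map_paired)
    ultimately have c: "continuous_map X X ((\<lambda>(g, x). \<phi> g x) \<circ> (\<lambda>x. (g, x)))"
      by (intro continuous_map_compose)
    have "continuous_map Y Y (f \<circ> (((\<lambda>(g, x). \<phi> g x) \<circ> (\<lambda>x. (g, x))) \<circ> f'))"
      by (rule continuous_map_compose[OF continuous_map_compose[OF homeo_continuous(2) c] homeo_continuous(1)])
    then show "continuous_map Y Y (\<lambda>y. case (g, y) of (g, y) \<Rightarrow> transport_action Y f f' \<phi> g y)"
      by (rule continuous_map_eq) (simp add: transport_action_def)
  qed
  moreover have "X homeomorphic_space Y" using hom by (auto simp: homeomorphic_space_def)
  ultimately show ?thesis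
    using assms homeo_closed homeomorphic_compact_space homeomorphic_Hausdorff_space
    unfolding flow_def by fastforce
qed

lemma free_flow_transport:
  assumes "free_flow G X \<phi>"
  shows "free_flow G Y (transport_action Y f f' \<phi>)"
proof -
  interpret group_action G "topspace X" \<phi> using assms by (simp add: free_flow_def flow_def)
  have "transport_action Y f f' \<phi> g y \<noteq> y"
    if g: "g \<in> carrier G - {\<one>\<^bsub>G\<^esub>}" and y: "y \<in> topspace Y" for g y
  proof
    assume "transport_action Y f f' \<phi> g y = y"
    then have "f' (f (\<phi> g (f' y))) = f' y" using y by (simp add: transport_action_def)
    moreover have "\<phi> g (f' y) \<in> topspace X" using element_image g y homeo_closed by blast
    ultimately have "\<phi> g (f' y) = f' y" using homeo_inverse by simp
    then show False using assms g homeo_closed(2)[OF y] by (auto simp: free_flow_def)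
  qed
  then show ?thesis using assms flow_transport by (auto simp: free_flow_def)
qed

lemma minimal_flow_transport:
  assumes "minimal_flow G X \<phi>"
  shows "minimal_flow G Y (transport_action Y f f' \<phi>)"
proof -
  interpret group_action G "topspace X" \<phi> using assms by (simp add: minimal_flow_def flow_def)
  have hm: "homeomorphic_map X Y f" using hom by (simp add: homeomorphic_maps_map)
  have "Y closure_of (orbit G (transport_action Y f f' \<phi>) y) = topspace Y" if y: "y \<in> topspace Y" for y
  proof -
    have "orbit G (transport_action Y f f' \<phi>) y = f ` orbit G \<phi> (f' y)"
      using y by (auto simp: orbit_def transport_action_def)
    moreover have "orbit G \<phi> (f' y) \<subseteq> topspace X"
      using element_image homeo_closed(2)[OF y] by (auto simp: orbit_def)
    moreover have "X closure_of (orbit G \<phi> (f' y)) = topspace X"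
      using assms homeo_closed(2)[OF y] by (simp add: minimal_flow_def)
    ultimately show ?thesis
      using homeomorphic_map_closure_of[OF hm] homeomorphic_imp_surjective_map[OF hm] by simp
  qed
  then show ?thesis using assms flow_transport by (auto simp: minimal_flow_def)
qed

end

text \<open>Pulling the topology back along the inverse turns an injection into a homeomorphism onto
  its image; this moves the final flow to the required type.\<close>

lemma homeomorphic_maps_pullback:
  assumes "inj_on f (topspace X)"
  defines "f' \<equiv> inv_into (topspace X) f"
  shows "homeomorphic_maps X (pullback_topology (f ` topspace X) f' X) f f'"
proof -
  have inv: "f' (f x) = x" if "x \<in> topspace X" for x
    using assms that by simp
  have top: "topspace (pullback_topology (f ` topspace X) f' X) = f ` topspace X"
    using inv by (auto simp: topspace_pullback_topology)
  have "continuous_map X X (f' \<circ> f)"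
    by (rule continuous_map_eq[OF continuous_map_id]) (simp add: inv)
  then have "continuous_map X (pullback_topology (f ` topspace X) f' X) f"
    by (rule continuous_map_pullback') auto
  moreover have "continuous_map (pullback_topology (f ` topspace X) f' X) X (id \<circ> f')"
    by (rule continuous_map_pullback) simp
  ultimately show ?thesis
    using inv top by (auto simp: homeomorphic_maps_def)
qed

section \<open>Topology of the full shift\<close>

context group
begin

lemma openin_cylinder:
  assumes "finite I" "x \<in> topspace config"
  shows "openin config {y \<in> topspace config. \<forall>i\<in>I. y i = x i}"
proof -
  have "openin config {y \<in> topspace config. y i \<in> {x i}}" if "i \<in> carrier G \<times> UNIV" for i
  proof (rule openin_continuous_map_preimage)
    show "continuous_map config (discrete_topology {..<3}) (\<lambda>y. y i)"
      unfolding config_def using that by (rule continuous_map_product_projection)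
    show "openin (discrete_topology {..<3}) {x i}"
      using that assms(2) by (auto simp: topspace_config)
  qed
  \<comment> \<open>Indices outside the domain impose nothing, since all configurations take the
    same default value there.\<close>
  moreover have "y i = x i" if "i \<notin> carrier G \<times> UNIV" "y \<in> topspace config" for y i
    using that assms(2) PiE_arb unfolding topspace_config by metis
  then have "{y \<in> topspace config. \<forall>i\<in>I. y i = x i} =
      topspace config \<inter> (\<Inter>i\<in>I \<inter> carrier G \<times> UNIV. {y \<in> topspace config. y i \<in> {x i}})"
    by auto
  moreover have "topspace config \<inter> (\<Inter>i\<in>J. A i) = (if J = {} then topspace config else (\<Inter>i\<in>J. A i))"
    if "\<And>i. i \<in> J \<Longrightarrow> A i \<subseteq> topspace config" for J and A :: "'a \<times> nat \<Rightarrow> _"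
    using that by auto
  ultimately show ?thesis
    using assms(1) by (auto intro!: openin_Int_Inter)
qed

lemma openin_config_cylinder:
  assumes "openin config U" "x \<in> U"
  obtains I where "finite I" "I \<subseteq> carrier G \<times> UNIV"
    "\<forall>y\<in>topspace config. (\<forall>i\<in>I. y i = x i) \<longrightarrow> y \<in> U"
proof -
  obtain S where S: "finite {i \<in> carrier G \<times> UNIV. S i \<noteq> {..<3}}"
    "x \<in> Pi\<^sub>E (carrier G \<times> UNIV) S" "Pi\<^sub>E (carrier G \<times> UNIV) S \<subseteq> U"
    using assms unfolding config_def openin_product_topology_alt by fastforce
  show thesis
  proof (rule that[OF S(1)]; intro ballI impI subsetI)
    fix y assume y: "y \<in> topspace config" and eq: "\<forall>i\<in>{i \<in> carrier G \<times> UNIV. S i \<noteq> {..<3}}. y i = x i"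
    have "y i \<in> S i" if i: "i \<in> carrier G \<times> UNIV" for i
    proof (cases "S i = {..<3}")
      case True
      then show ?thesis using y i PiE_mem unfolding topspace_config by metis
    next
      case False
      then have "y i = x i" using eq i by blast
      then show ?thesis using PiE_mem[OF S(2) i] by simp
    qed
    then have "y \<in> Pi\<^sub>E (carrier G \<times> UNIV) S"
      using y unfolding topspace_config by (simp add: PiE_iff)
    then show "y \<in> U" using S(3) by blast
  qed auto
qed

text \<open>Finite cylinders form a neighbourhood base, so closure, and with it minimality, becomes
  a question about finite patterns.\<close>

lemma in_closure_config:
  assumes "X \<subseteq> topspace config"
  shows "x \<in> config closure_of X \<longleftrightarrow> x \<in> topspace config \<and>
    (\<forall>I. finite I \<and> I \<subseteq> carrier G \<times> UNIV \<longrightarrow> (\<exists>y\<in>X. \<forall>i\<in>I. y i = x i))"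
proof (intro iffI conjI allI impI)
  assume x: "x \<in> config closure_of X"
  then show xc: "x \<in> topspace config" by (simp add: in_closure_of)
  fix I assume "finite I \<and> I \<subseteq> carrier G \<times> (UNIV :: nat set)"
  then have "openin config {y \<in> topspace config. \<forall>i\<in>I. y i = x i}"
    using openin_cylinder xc by blast
  then show "\<exists>y\<in>X. \<forall>i\<in>I. y i = x i"
    using x xc by (auto simp: in_closure_of dest!: spec[of _ "{y \<in> topspace config. \<forall>i\<in>I. y i = x i}"])
next
  assume x: "x \<in> topspace config \<and>
    (\<forall>I. finite I \<and> I \<subseteq> carrier G \<times> UNIV \<longrightarrow> (\<exists>y\<in>X. \<forall>i\<in>I. y i = x i))"
  have "\<exists>y. y \<in> X \<and> y \<in> T" if T: "x \<in> T" "openin config T" for T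
  proof -
    obtain I where I: "finite I" "I \<subseteq> carrier G \<times> UNIV"
      "\<forall>y\<in>topspace config. (\<forall>i\<in>I. y i = x i) \<longrightarrow> y \<in> T"
      using openin_config_cylinder[OF T(2,1)] .
    then have "\<exists>y\<in>X. \<forall>i\<in>I. y i = x i" using x by simp
    then obtain y where "y \<in> X" "\<forall>i\<in>I. y i = x i" by (elim bexE)
    then show ?thesis using I(3) assms by auto
  qed
  then show "x \<in> config closure_of X" using x by (auto simp: in_closure_of)
qed

lemma compact_space_config: "compact_space config"
  by (simp add: config_def compact_space_product_topology compact_space_discrete_topology)

lemma Hausdorff_space_config: "Hausdorff_space config"
  by (simp add: config_def Hausdorff_space_product_topology Hausdorff_space_discrete_topology)

lemma continuous_map_shift:
  assumes "g \<in> carrier G"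
  shows "continuous_map config config (shift g)"
proof -
  have "continuous_map config (discrete_topology {..<3}) (\<lambda>x. shift g x i)"
    if i: "i \<in> carrier G \<times> UNIV" for i
  proof -
    obtain h n where hn: "i = (h, n)" "h \<in> carrier G" using i by auto
    then have "continuous_map config (discrete_topology {..<3}) (\<lambda>x. x (inv g \<otimes> h, n))"
      unfolding config_def using assms by (intro continuous_map_product_projection) auto
    then show ?thesis using hn by (simp add: shift_apply)
  qed
  moreover have "shift g \<in> topspace config \<rightarrow> extensional (carrier G \<times> UNIV)"
    by (auto simp: shift_def)
  ultimately show ?thesis
    unfolding config_def continuous_map_componentwise by (auto simp flip: config_def)
qed

lemma shift_closure_of:
  assumes "X \<subseteq> topspace config" "\<And>g x. g \<in> carrier G \<Longrightarrow> x \<in> X \<Longrightarrow> shift g x \<in> X"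
    and "g \<in> carrier G" "x \<in> config closure_of X"
  shows "shift g x \<in> config closure_of X"
proof -
  have "shift g ` (config closure_of X) \<subseteq> config closure_of (shift g ` X)"
    by (rule continuous_map_image_closure_subset[OF continuous_map_shift[OF assms(3)]])
  also have "\<dots> \<subseteq> config closure_of X"
    using assms by (intro closure_of_mono) auto
  finally show ?thesis using assms(4) by blast
qed

lemma flow_shift:
  assumes K: "closedin config K" "K \<noteq> {}" "\<And>g x. g \<in> carrier G \<Longrightarrow> x \<in> K \<Longrightarrow> shift g x \<in> K"
  shows "flow G (subtopology config K) (\<lambda>g. restrict (shift g) K)"
proof -
  have Kc: "K \<subseteq> topspace config" using K(1) by (rule closedin_subset)
  then have top: "topspace (subtopology config K) = K" by (simp add: Int_absorb1)
  have "group_action G K (\<lambda>g. restrict (shift g) K)"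
    using K(3) Kc by (intro group_actionI) (auto simp: shift_one shift_mult subset_iff)
  moreover have "continuous_map (prod_topology (discrete_topology (carrier G)) (subtopology config K))
      (subtopology config K) (\<lambda>(g, x). restrict (shift g) K x)"
  proof (rule continuous_map_prod_discrete)
    fix g assume g: "g \<in> carrier G"
    have "continuous_map (subtopology config K) (subtopology config K) (shift g)"
      using continuous_map_shift[OF g] K(3)[OF g]
      by (auto simp: continuous_map_in_subtopology continuous_map_from_subtopology)
    then show "continuous_map (subtopology config K) (subtopology config K)
        (\<lambda>x. case (g, x) of (g, x) \<Rightarrow> restrict (shift g) K x)"
      by (rule continuous_map_eq) (simp add: top)
  qed
  moreover have "compact_space (subtopology config K)"
    using closedin_compact_space[OF compact_space_config K(1)] by (simp add: compact_space_subtopology)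
  ultimately show ?thesis
    unfolding flow_def top using K(2) Hausdorff_space_subtopology[OF Hausdorff_space_config] by blast
qed


section \<open>The decreasing sequence and its limit\<close>

lemma flexible_sequence:
  assumes g: "\<And>n. g n \<in> carrier G" and N: "\<And>k. N k \<lhd> G" "\<And>k. infinite (N k)"
  shows "\<exists>X L. \<forall>n. flexible n (X n) \<and> X (Suc n) \<subseteq> X n \<and>
     (\<forall>x\<in>X (Suc n). g n \<noteq> \<one> \<longrightarrow> (\<forall>h\<in>carrier G. x (h, n) \<noteq> x (h \<otimes> g n, n))) \<and>
     finite (L n) \<and> L n \<subseteq> N (fst (prod_decode n)) \<and>
     (\<forall>x\<in>X (Suc n). \<forall>y\<in>X (Suc n). \<exists>d\<in>L n. \<forall>e\<in>g ` {..n}. \<forall>j\<le>n. y (d \<otimes> e, j) = x (e, j))"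
proof -
  (* decoding n as a pair makes every \<open>N k\<close> occur at arbitrarily late steps *)
  define Q where "Q n X X' \<longleftrightarrow> X' \<subseteq> X \<and>
     (\<forall>x\<in>X'. g n \<noteq> \<one> \<longrightarrow> (\<forall>h\<in>carrier G. x (h, n) \<noteq> x (h \<otimes> g n, n))) \<and>
     (\<exists>L. finite L \<and> L \<subseteq> N (fst (prod_decode n)) \<and>
        (\<forall>x\<in>X'. \<forall>y\<in>X'. \<exists>d\<in>L. \<forall>e\<in>g ` {..n}. \<forall>j\<le>n. y (d \<otimes> e, j) = x (e, j)))"
    for n and X X' :: "('a \<times> nat \<Rightarrow> nat) set"
  have step: "\<exists>X'. flexible (Suc n) X' \<and> Q n X X'" if X: "flexible n X" for n X
  proof -
    \<comment> \<open>Colouring comes first: the recurrence step passes to a subset, which keeps the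
      colouring, and its patterns then include layer \<open>n\<close>.\<close>
    define Y where "Y = {x \<in> X. g n \<noteq> \<one> \<longrightarrow> (\<forall>h\<in>carrier G. x (h, n) \<noteq> x (h \<otimes> g n, n))}"
    have Y: "flexible (Suc n) Y" unfolding Y_def by (rule flexible_colour_layer[OF X g])
    have "finite (g ` {..n})" "g ` {..n} \<subseteq> carrier G" using g by auto
    from flexible_minimality[OF Y N this] obtain X' L where X': "flexible (Suc n) X'" "X' \<subseteq> Y"
      and L: "finite L" "L \<subseteq> N (fst (prod_decode n))"
        "\<forall>x\<in>X'. \<forall>y\<in>X'. \<exists>d\<in>L. \<forall>e\<in>g ` {..n}. \<forall>j<Suc n. y (d \<otimes> e, j) = x (e, j)" .
    have "Q n X X'"
      unfolding Q_def
    proof (intro conjI exI[of _ L])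
      show "X' \<subseteq> X" "\<forall>x\<in>X'. g n \<noteq> \<one> \<longrightarrow> (\<forall>h\<in>carrier G. x (h, n) \<noteq> x (h \<otimes> g n, n))"
        using X'(2) by (auto simp: Y_def)
    qed (use L in \<open>auto simp: less_Suc_eq_le\<close>)
    then show ?thesis using X'(1) by blast
  qed
  obtain X where X: "\<And>n. flexible n (X n)" "\<And>n. Q n (X n) (X (Suc n))"
    using dependent_nat_choice[of flexible Q] flexible_config step by metis
  \<comment> \<open>\<open>Q\<close> hides \<open>L\<close> behind a quantifier so that dependent
    choice selects only the sets; a suitable \<open>L n\<close> is then chosen for each
    \<open>n\<close>.\<close>
  have "\<exists>L. finite L \<and> L \<subseteq> N (fst (prod_decode n)) \<and> (\<forall>x\<in>X (Suc n). \<forall>y\<in>X (Suc n).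
      \<exists>d\<in>L. \<forall>e\<in>g ` {..n}. \<forall>j\<le>n. y (d \<otimes> e, j) = x (e, j))" for n
    using X(2)[of n] by (simp add: Q_def)
  then obtain L where L: "\<forall>n. finite (L n) \<and> L n \<subseteq> N (fst (prod_decode n)) \<and>
      (\<forall>x\<in>X (Suc n). \<forall>y\<in>X (Suc n).
      \<exists>d\<in>L n. \<forall>e\<in>g ` {..n}. \<forall>j\<le>n. y (d \<otimes> e, j) = x (e, j))" by metis
  then show ?thesis
    using X by (intro exI[of _ X] exI[of _ L]) (simp add: Q_def)
qed

text \<open>Nested nonempty closures in a compact space have a common point. Freeness and recurrence
  pass from \<open>X (Suc n)\<close> to \<open>K\<close> because each instance involves finitely
  many coordinates; for recurrence this relies on \<open>L n\<close> being finite.\<close>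

lemma exists_minimal_shift:
  fixes N :: "nat \<Rightarrow> 'a set"
  assumes "countable (carrier G)" and N: "\<And>k. N k \<lhd> G" "\<And>k. infinite (N k)"
  shows "\<exists>K. closedin config K \<and> K \<noteq> {} \<and> (\<forall>g\<in>carrier G. \<forall>x\<in>K. shift g x \<in> K) \<and>
     (\<forall>g\<in>carrier G - {\<one>}. \<forall>x\<in>K. shift g x \<noteq> x) \<and>
     (\<forall>k. \<forall>x\<in>K. \<forall>y\<in>K. \<forall>I. finite I \<and> I \<subseteq> carrier G \<times> UNIV \<longrightarrow>
       (\<exists>d\<in>N k. \<forall>i\<in>I. shift d y i = x i))"
proof -
  define g where "g = from_nat_into (carrier G)"
  have ne: "carrier G \<noteq> {}" by auto
  have g: "g n \<in> carrier G" for n using ne by (simp add: g_def from_nat_into)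
  have g_surj: "\<exists>n. g n = h" if "h \<in> carrier G" for h
    using from_nat_into_surj[OF assms(1) that] by (simp add: g_def)
  obtain X L where "\<forall>n. flexible n (X n) \<and> X (Suc n) \<subseteq> X n \<and>
     (\<forall>x\<in>X (Suc n). g n \<noteq> \<one> \<longrightarrow> (\<forall>h\<in>carrier G. x (h, n) \<noteq> x (h \<otimes> g n, n))) \<and>
     finite (L n) \<and> L n \<subseteq> N (fst (prod_decode n)) \<and>
     (\<forall>x\<in>X (Suc n). \<forall>y\<in>X (Suc n). \<exists>d\<in>L n. \<forall>e\<in>g ` {..n}. \<forall>j\<le>n. y (d \<otimes> e, j) = x (e, j))"
    using flexible_sequence[of g N, OF g N] by (elim exE)
  then have X: "flexible n (X n)" "X (Suc n) \<subseteq> X n"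
    and colour: "\<forall>x\<in>X (Suc n). g n \<noteq> \<one> \<longrightarrow> (\<forall>h\<in>carrier G. x (h, n) \<noteq> x (h \<otimes> g n, n))"
    and L: "finite (L n)" "L n \<subseteq> N (fst (prod_decode n))"
    and recur: "\<forall>x\<in>X (Suc n). \<forall>y\<in>X (Suc n).
      \<exists>d\<in>L n. \<forall>e\<in>g ` {..n}. \<forall>j\<le>n. y (d \<otimes> e, j) = x (e, j)" for n
    by simp_all
  have NG: "N k \<subseteq> carrier G" for k
    using N(1)[of k] by (simp add: normal_imp_subgroup subgroup.subset)
  have Xc: "X n \<subseteq> topspace config" for n using X(1)[of n] by (simp add: flexible_def)
  define C where "C n = config closure_of X n" for n
  define K where "K = (\<Inter>n. C n)"
  have closedC: "closedin config (C n)" for n by (simp add: C_def)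
  have "C n \<noteq> {}" for n
  proof -
    have "X n \<noteq> {}" using X(1)[of n] glues_nonempty by (auto simp: flexible_def)
    then show ?thesis using closure_of_subset[OF Xc[of n]] by (auto simp: C_def)
  qed
  moreover have "decseq C"
    using X(2) by (intro decseq_SucI) (simp add: C_def closure_of_mono)
  ultimately have K_ne: "K \<noteq> {}"
    unfolding K_def by (intro compact_space_imp_nest[OF compact_space_config closedC])
  have K_approx: "\<exists>x'\<in>X n. \<forall>i\<in>I. x' i = x i" if "x \<in> K" "finite I" "I \<subseteq> carrier G \<times> UNIV" for x n I
    using that in_closure_config[OF Xc] unfolding K_def C_def by simp
  have K_closed: "closedin config K" unfolding K_def using closedC by (intro closedin_Inter) auto
  have K_shift: "shift h x \<in> K" if "h \<in> carrier G" "x \<in> K" for h x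
    using that shift_closure_of[OF Xc] X(1) unfolding K_def C_def flexible_def by simp
  have free: "shift h x \<noteq> x" if h: "h \<in> carrier G" "x \<in> K" "h \<noteq> \<one>" for h x
  proof
    assume eq: "shift h x = x"
    \<comment> \<open>A fixed point of \<open>h\<close> has equal colours at \<open>\<one>\<close>
      and \<open>inv h\<close>, but these are neighbours in the layer coloured for
      \<open>inv h\<close>.\<close>
    obtain n where n: "g n = inv h" using g_surj h(1) by blast
    obtain x' where x': "x' \<in> X (Suc n)" "\<forall>i\<in>{(\<one>, n), (inv h, n)}. x' i = x i"
      using K_approx[OF h(2), of "{(\<one>, n), (inv h, n)}" "Suc n"] h(1) by auto
    have "g n \<noteq> \<one>" using h n by (metis inv_inv inv_one)
    then have "x' (\<one>, n) \<noteq> x' (inv h, n)"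
      using colour[of n] x'(1) n h(1) by (metis one_closed l_one inv_closed)
    moreover have "x (\<one>, n) = x (inv h, n)"
      using fun_cong[OF eq, of "(\<one>, n)"] h(1) by (simp add: shift_apply)
    ultimately show False using x'(2) by simp
  qed
  have min: "\<exists>d\<in>N k. \<forall>i\<in>I. shift d y i = x i"
    if xy: "x \<in> K" "y \<in> K" and I: "finite I" "I \<subseteq> carrier G \<times> UNIV" for k x y I
  proof -
    have "\<exists>m. \<forall>i\<in>I. fst i \<in> g ` {..m} \<and> snd i \<le> m"
      using I
    proof (induction I)
      case (insert i I)
      then obtain m where m: "\<forall>i\<in>I. fst i \<in> g ` {..m} \<and> snd i \<le> m" by auto
      obtain l where l: "g l = fst i" using g_surj[of "fst i"] insert(4) by auto
      have "fst i \<in> g ` {..m + l + snd i}" using l by (intro image_eqI[of _ _ l]) auto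
      then show ?case using m by (intro exI[of _ "m + l + snd i"]) fastforce
    qed auto
    then obtain m where m: "\<forall>i\<in>I. fst i \<in> g ` {..m} \<and> snd i \<le> m" by blast
    \<comment> \<open>The encoding gives a step that treats \<open>N k\<close> and, as
      \<open>m \<le> n\<close>, has a window covering \<open>I\<close>.\<close>
    define n where "n = prod_encode (k, m)"
    have n: "m \<le> n" "fst (prod_decode n) = k" by (simp_all add: n_def le_prod_encode_2)
    define E where "E = g ` {..n} \<times> {..n}"
    \<comment> \<open>The element \<open>d\<close> is found only after \<open>y\<close> has been
      approximated, so the approximation must hold on the translates by all of
      \<open>L n\<close>.\<close>
    define E' where "E' = (\<lambda>(d, e, j). (d \<otimes> e, j)) ` (L n \<times> E)"
    have LG: "L n \<subseteq> carrier G" using L(2) NG by blast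
    have E: "finite E" "E \<subseteq> carrier G \<times> UNIV" using g by (auto simp: E_def)
    have E': "finite E'" "E' \<subseteq> carrier G \<times> UNIV"
      using L(1) E LG by (auto simp: E'_def)
    obtain x' where x': "x' \<in> X (Suc n)" "\<forall>i\<in>E. x' i = x i" using K_approx[OF xy(1) E] by blast
    obtain y' where y': "y' \<in> X (Suc n)" "\<forall>i\<in>E'. y' i = y i" using K_approx[OF xy(2) E'] by blast
    obtain d where d: "d \<in> L n" "\<forall>e\<in>g ` {..n}. \<forall>j\<le>n. y' (d \<otimes> e, j) = x' (e, j)"
      using recur[of n] x'(1) y'(1) by blast
    have dG: "d \<in> carrier G" using d LG by blast
    \<comment> \<open>The inverse enters because \<open>shift (inv d) y\<close> reads
      \<open>y\<close> at \<open>d \<otimes> e\<close>.\<close>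
    have "shift (inv d) y i = x i" if "i \<in> I" for i
    proof -
      obtain e j where i: "i = (e, j)" by (cases i)
      have "e \<in> g ` {..n}" "j \<le> n"
        using m that n(1) i by (force, force)
      then have ej: "e \<in> g ` {..n}" "j \<le> n" "(e, j) \<in> E" by (auto simp: E_def)
      then have eE': "(d \<otimes> e, j) \<in> E'" using d(1) unfolding E'_def by (force intro: image_eqI[of _ _ "(d, e, j)"])
      have "shift (inv d) y (e, j) = y (d \<otimes> e, j)"
        using ej(1) g dG by (auto simp: shift_apply)
      also have "\<dots> = y' (d \<otimes> e, j)" using y'(2) eE' by simp
      also have "\<dots> = x' (e, j)" using d(2) ej(1,2) by blast
      also have "\<dots> = x (e, j)" using x'(2) ej by simp
      finally show ?thesis using i by simp
    qed
    moreover have "inv d \<in> N k"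
      using d(1) L(2)[of n] n(2) subgroup.m_inv_closed[OF normal_imp_subgroup[OF N(1)]] by blast
    ultimately show ?thesis by blast
  qed
  show ?thesis
    using K_closed K_ne K_shift free min by (intro exI[of _ K]) simp
qed

text \<open>By \<open>in_closure_config\<close>, the assumption \<open>min\<close> is exactly
  density of the orbits of \<open>H\<close> in \<open>K\<close>, tested on finite cylinders.\<close>

lemma minimal_flow_shift:
  assumes H: "subgroup H G" and K: "closedin config K" "K \<noteq> {}"
    "\<And>g x. g \<in> carrier G \<Longrightarrow> x \<in> K \<Longrightarrow> shift g x \<in> K"
    and min: "\<And>x y I. x \<in> K \<Longrightarrow> y \<in> K \<Longrightarrow> finite I \<Longrightarrow> I \<subseteq> carrier G \<times> UNIV \<Longrightarrow>
       \<exists>d\<in>H. \<forall>i\<in>I. shift d y i = x i"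
  shows "minimal_flow (G\<lparr>carrier := H\<rparr>) (subtopology config K) (\<lambda>g. restrict (shift g) K)"
proof -
  have Kc: "K \<subseteq> topspace config" using K(1) by (rule closedin_subset)
  then have top: "topspace (subtopology config K) = K" by (simp add: Int_absorb1)
  have HG: "H \<subseteq> carrier G" using H by (rule subgroup.subset)
  have "subtopology config K closure_of (orbit (G\<lparr>carrier := H\<rparr>) (\<lambda>g. restrict (shift g) K) y) = K"
    if y: "y \<in> K" for y
  proof -
    define Orb where "Orb = orbit (G\<lparr>carrier := H\<rparr>) (\<lambda>g. restrict (shift g) K) y"
    have Orb: "Orb = (\<lambda>d. shift d y) ` H" using y by (auto simp: Orb_def orbit_def)
    then have OK: "Orb \<subseteq> K" using K(3) y HG by auto
    have "K \<subseteq> config closure_of Orb"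
    proof
      fix x assume x: "x \<in> K"
      have "\<exists>z\<in>Orb. \<forall>i\<in>I. z i = x i" if "finite I" "I \<subseteq> carrier G \<times> UNIV" for I
        using min[OF x y that] unfolding Orb by simp
      moreover have "x \<in> topspace config" using x Kc by blast
      ultimately show "x \<in> config closure_of Orb"
        unfolding in_closure_config[OF order_trans[OF OK Kc]] by simp
    qed
    then show ?thesis
      using OK by (simp add: closure_of_subtopology Int_absorb1 flip: Orb_def) blast
  qed
  then show ?thesis
    unfolding minimal_flow_def top using flow_restrict[OF flow_shift[OF K] H] by blast
qed

end

theorem theorem3:
  fixes G :: "('a, 'm) monoid_scheme" and \<Delta> :: "nat \<Rightarrow> 'a set"
  assumes "group G"
    and "countable (carrier G)" and "infinite (carrier G)"
    and "\<And>n. \<Delta> n \<lhd> G" and "\<And>n. infinite (\<Delta> n)"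
  shows "\<exists>(X :: 'a set set topology) \<phi>.
           free_flow G X \<phi> \<and> (\<forall>n. minimal_flow (G\<lparr>carrier := \<Delta> n\<rparr>) X \<phi>)"
proof -
  interpret group G by (rule assms(1))
  obtain K where "closedin config K \<and> K \<noteq> {} \<and> (\<forall>g\<in>carrier G. \<forall>x\<in>K. shift g x \<in> K) \<and>
     (\<forall>g\<in>carrier G - {\<one>\<^bsub>G\<^esub>}. \<forall>x\<in>K. shift g x \<noteq> x) \<and>
     (\<forall>k. \<forall>x\<in>K. \<forall>y\<in>K. \<forall>I. finite I \<and> I \<subseteq> carrier G \<times> UNIV \<longrightarrow>
       (\<exists>d\<in>\<Delta> k. \<forall>i\<in>I. shift d y i = x i))"
    using exists_minimal_shift[of \<Delta>, OF assms(2,4,5)] by (elim exE)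
  then have K: "closedin config K" "K \<noteq> {}" "\<And>g x. g \<in> carrier G \<Longrightarrow> x \<in> K \<Longrightarrow> shift g x \<in> K"
    and free: "\<And>g x. g \<in> carrier G - {\<one>\<^bsub>G\<^esub>} \<Longrightarrow> x \<in> K \<Longrightarrow> shift g x \<noteq> x"
    and min: "\<And>k x y I. x \<in> K \<Longrightarrow> y \<in> K \<Longrightarrow> finite I \<Longrightarrow> I \<subseteq> carrier G \<times> UNIV \<Longrightarrow>
       \<exists>d\<in>\<Delta> k. \<forall>i\<in>I. shift d y i = x i"
    by simp_all
  define X where "X = subtopology config K"
  define \<phi> where "\<phi> = (\<lambda>g. restrict (shift g) K)"
  have top: "topspace X = K"
    using closedin_subset[OF K(1)] by (simp add: X_def Int_absorb1)
  have "flow G X \<phi>" unfolding X_def \<phi>_def by (rule flow_shift[OF K])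
  then have fr: "free_flow G X \<phi>"
    using free by (auto simp: free_flow_def top \<phi>_def)
  have mn: "minimal_flow (G\<lparr>carrier := \<Delta> n\<rparr>) X \<phi>" for n
    unfolding X_def \<phi>_def
    by (rule minimal_flow_shift[OF normal_imp_subgroup[OF assms(4)] K min])
  \<comment> \<open>A dense orbit of any one \<open>\<Delta> n\<close> bounds the size of
    \<open>K\<close>, so \<open>K\<close> embeds into the type required by the conclusion.\<close>
  obtain f :: "('a \<times> nat \<Rightarrow> nat) \<Rightarrow> 'a set set" where "inj_on f (topspace X)"
    using minimal_flow_inj_set_set[OF mn] by blast
  note hom = homeomorphic_maps_pullback[OF this]
  show ?thesis
    using free_flow_transport[OF hom fr] minimal_flow_transport[OF hom mn] by blast
qed

end
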